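(* Let $G$ be a compactly covered totally disconnected locally compact abelian group and $\phi:G\to G$ a topological automorphism. Then: (a) for every closed subgroup $U$ of $G$, $U\in\mathcal B(G)$ if and only if $U^\perp\in\mathcal B(\widehat G)$; (b) for every $U\in\mathcal B(G)$, $s(\phi,U)=s(\widehat\phi,U^\perp)$; (c) for every closed subgroup $U$ of $G$, $U\in\mathcal M(G,\phi)$ if and only if $U^\perp\in\mathcal M(\widehat G,\widehat\phi)$; (d) $s(\widehat\phi)=s(\phi)$.
   Context: A locally compact group $G$ is compactly covered if every element of $G$ is contained in some compact subgroup of $G$. A topological automorphism is a group automorphism that is also a homeomorphism. Duality: for a locally compact abelian group $G$, $\widehat G$ is its Pontryagin dual, i.e. the group of continuous homomorphisms $\chi:G\to\mathbb T$ (circle group, written additively) with the compact-open topology; $\widehat\phi:\widehat G\to\widehat G$ is the dual automorphism $\widehat\phi(\chi)=\chi\circ\phi$; for $X\subseteq G$, $X^\perp=\{\chi\in\widehat G:\chi(x)=0\ \forall x\in X\}$. When $G$ is locally compact abelian, $G$ is compactly covered if and only if $\widehat G$ is totally disconnected, so under the hypotheses the notions below make sense for $\widehat G$ too. Scale: for a totally disconnected locally compact group $G$ and a topological automorphism $\phi$ of $G$, $\mathcal B(G)$ is the family of all compact open subgroups of $G$; for $U\in\mathcal B(G)$, $s(\phi,U)=[\phi(U):U\cap\phi(U)]$ (a finite index); $s(\phi)=\min\{s(\phi,U):U\in\mathcal B(G)\}$; and $\mathcal M(G,\phi)=\{U\in\mathcal B(G):s(\phi,U)=s(\phi)\}$ is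 the family of minimizing subgroups for $\phi$. *)

theory Defs
  imports "HOL-Analysis.Analysis" "HOL-Algebra.Coset"
begin

text \<open>
  A topological group is a group in the sense of HOL-Algebra (written multiplicatively, also
  when it is abelian) together with an abstract topology on its carrier.
\<close>

locale topological_group = group G for G (structure) and T :: "'a topology" +
  assumes topspace_eq_carrier: "topspace T = carrier G"
    and continuous_map_mult: "continuous_map (prod_topology T T) T (\<lambda>(x, y). x \<otimes> y)"
    and continuous_map_inv: "continuous_map T T (\<lambda>x. inv x)"

locale locally_compact_abelian_group = topological_group G T + comm_group G
  for G (structure) and T :: "'a topology" +
  assumes locally_compact: "locally_compact_space T"
    and Hausdorff: "Hausdorff_space T"

definition totally_disconnected_space :: "'a topology \<Rightarrow> bool" where
  "totally_disconnected_space X \<longleftrightarrow>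
     (\<forall>x \<in> topspace X. connected_component_of_set X x = {x})"

definition compactly_covered :: "('a, 'm) monoid_scheme \<Rightarrow> 'a topology \<Rightarrow> bool" where
  "compactly_covered G T \<longleftrightarrow>
     (\<forall>x \<in> carrier G. \<exists>K. subgroup K G \<and> compactin T K \<and> x \<in> K)"

definition topological_automorphism ::
    "('a, 'm) monoid_scheme \<Rightarrow> 'a topology \<Rightarrow> ('a \<Rightarrow> 'a) \<Rightarrow> bool" where
  "topological_automorphism G T \<phi> \<longleftrightarrow> \<phi> \<in> iso G G \<and> homeomorphic_map T T \<phi>"

subsection \<open>Pontryagin duality\<close>

text \<open>
  The circle group is the group of complex numbers of modulus one under multiplication, so the
  neutral element, written 0 in additive notation for the circle, is the number 1.
\<close>

definition circle_group :: "complex monoid" where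
  "circle_group = \<lparr>carrier = sphere 0 1, mult = (*), one = 1\<rparr>"

definition circle_topology :: "complex topology" where
  "circle_topology = top_of_set (sphere 0 1)"

text \<open>
  Continuous maps are represented by functions that are \<^const>\<open>undefined\<close> outside
  the space, so that each map has exactly one representative. The sets used as a subbase
  cover the whole set of continuous maps (take \<open>K\<close> empty).
\<close>

definition compact_open_topology :: "'a topology \<Rightarrow> 'b topology \<Rightarrow> ('a \<Rightarrow> 'b) topology" where
  "compact_open_topology X Y = topology_generated_by
     {{f \<in> extensional (topspace X). continuous_map X Y f \<and> f ` K \<subseteq> V} | K V.
        compactin X K \<and> openin Y V}"

definition dual_group :: "('a, 'm) monoid_scheme \<Rightarrow> 'a topology \<Rightarrow> ('a \<Rightarrow> complex) monoid" where
  "dual_group G T =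
     \<lparr>carrier = {\<xi> \<in> extensional (carrier G).
                    \<xi> \<in> hom G circle_group \<and> continuous_map T circle_topology \<xi>},
      mult = (\<lambda>\<xi> \<eta>. \<lambda>x \<in> carrier G. \<xi> x \<otimes>\<^bsub>circle_group\<^esub> \<eta> x),
      one = (\<lambda>x \<in> carrier G. \<one>\<^bsub>circle_group\<^esub>)\<rparr>"

definition dual_topology ::
    "('a, 'm) monoid_scheme \<Rightarrow> 'a topology \<Rightarrow> ('a \<Rightarrow> complex) topology" where
  "dual_topology G T =
     subtopology (compact_open_topology T circle_topology) (carrier (dual_group G T))"

definition dual_map ::
    "('a, 'm) monoid_scheme \<Rightarrow> ('a \<Rightarrow> 'a) \<Rightarrow> ('a \<Rightarrow> complex) \<Rightarrow> ('a \<Rightarrow> complex)" where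
  "dual_map G \<phi> = (\<lambda>\<xi>. \<lambda>x \<in> carrier G. \<xi> (\<phi> x))"

definition annihilator_in_dual ::
    "('a, 'm) monoid_scheme \<Rightarrow> 'a topology \<Rightarrow> 'a set \<Rightarrow> ('a \<Rightarrow> complex) set" where
  "annihilator_in_dual G T X =
     {\<xi> \<in> carrier (dual_group G T). \<forall>x \<in> X. \<xi> x = \<one>\<^bsub>circle_group\<^esub>}"

subsection \<open>Scale and minimizing subgroups\<close>

definition compact_open_subgroups :: "('a, 'm) monoid_scheme \<Rightarrow> 'a topology \<Rightarrow> 'a set set" where
  "compact_open_subgroups G T = {U. subgroup U G \<and> compactin T U \<and> openin T U}"

definition subgroup_index :: "('a, 'm) monoid_scheme \<Rightarrow> 'a set \<Rightarrow> 'a set \<Rightarrow> nat" where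
  "subgroup_index G K H = card (rcosets\<^bsub>G\<lparr>carrier := K\<rparr>\<^esub> H)"

text \<open>
  For a topological automorphism \<open>\<phi>\<close> and a compact open subgroup \<open>U\<close> the index below
  is finite: the cosets of the open subgroup \<open>U \<inter> \<phi>(U)\<close> partition the compact
  group \<open>\<phi>(U)\<close>. So the value 0 of \<^const>\<open>card\<close> on infinite sets does not arise.
\<close>

definition scale_at :: "('a, 'm) monoid_scheme \<Rightarrow> ('a \<Rightarrow> 'a) \<Rightarrow> 'a set \<Rightarrow> nat" where
  "scale_at G \<phi> U = subgroup_index G (\<phi> ` U) (U \<inter> \<phi> ` U)"

text \<open>
  The minimum of a set of natural numbers, which is nonempty when the group is totally
  disconnected and locally compact, by van Dantzig's theorem.
\<close>

definition scale_aut :: "('a, 'm) monoid_scheme \<Rightarrow> 'a topology \<Rightarrow> ('a \<Rightarrow> 'a) \<Rightarrow> nat" where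
  "scale_aut G T \<phi> = (LEAST n. \<exists>U \<in> compact_open_subgroups G T. n = scale_at G \<phi> U)"

definition minimizing_subgroups ::
    "('a, 'm) monoid_scheme \<Rightarrow> 'a topology \<Rightarrow> ('a \<Rightarrow> 'a) \<Rightarrow> 'a set set" where
  "minimizing_subgroups G T \<phi> =
     {U \<in> compact_open_subgroups G T. scale_at G \<phi> U = scale_aut G T \<phi>}"

end

theory Submission
  imports Defs "HOL-Algebra.Multiplicative_Group"
begin

text \<open>
  Write \<open>annih U\<close> for the annihilator of \<open>U\<close> in the dual group. The proof transports compact open
  subgroups and indices through \<open>annih\<close> without the Pontryagin duality theorem. It has three
  ingredients.

  First, there are enough characters. A totally disconnected locally compact group has arbitrarily
  small compact open subgroups (\<open>van_Dantzig\<close>), and a homomorphism from a subgroup of an abelian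
  group into the circle extends, because the circle is divisible (\<open>partial_hom_extends\<close>). A homomorphism
  that is trivial on an open subgroup is continuous. So the elements outside a closed subgroup \<open>H\<close>
  are separated from it by characters in \<open>annih H\<close> (\<open>closed_subgroup_separated\<close>), and \<open>H\<close> is
  recovered from \<open>annih H\<close> as the set of common zeros.

  Second, topology. If \<open>U\<close> is compact, then \<open>annih U\<close> is open, since the circle has no small
  subgroups; if \<open>U\<close> is open, then \<open>annih U\<close> is compact, by Tychonoff's theorem. Conversely, every
  open subgroup of the dual group contains \<open>annih W\<close> for some compact open \<open>W\<close>, since in a
  compactly covered group each compact set lies in such a \<open>W\<close>; and every compact subset of the dual
  group is contained in \<open>annih V\<close> for some compact open \<open>V\<close>, since these annihilators are a directed
  open cover. If \<open>annih U\<close> is compact and open, it follows that \<open>V \<subseteq> U \<subseteq> W\<close>, so that a closed \<open>U\<close>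
  is compact and open. This is part (a).

  Third, counting. A pairing of two abelian groups with values in the circle makes the indices of its
  two kernels equal when one of them is finite (\<open>pairing_index_eq\<close>); this follows by summing the
  pairing in two ways. Pairing \<open>\<phi> ` U\<close> with the image of \<open>annih U\<close> under the dual map gives
  part (b). The same lemma shows that a compact open subgroup \<open>N\<close> of the dual group has the same
  finite index over some \<open>annih W\<close> as the larger group \<open>annih U\<close>, where \<open>U\<close> is the set of common zeros
  of \<open>N\<close>; so \<open>N = annih U\<close>, and every compact open subgroup of the dual group is an annihilator. With
  (b), the scales are minima of the same set, which is (d), and (c) follows from (a), (b)
  and (d).
\<close>

section \<open>Extending homomorphisms into divisible groups\<close>

text \<open>
  The exponents form a subgroup of the integers, hence are the multiples of a single \<open>n\<close>. The
  value \<open>n = 0\<close> covers the case that no nontrivial power of \<open>y\<close> lies in \<open>H\<close>.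
\<close>

lemma (in group) exponents_into_subgroup:
  assumes H: "subgroup H G" and y: "y \<in> carrier G"
  obtains n :: nat where "\<And>k::int. y [^] k \<in> H \<longleftrightarrow> int n dvd k"
proof (cases "\<exists>n>0. y [^] (int n) \<in> H")
  case False
  then have noexp: "n = 0" if "y [^] int n \<in> H" for n :: nat
    using that by (metis neq0_conv)
  have "y [^] k \<in> H \<longleftrightarrow> int 0 dvd k" for k :: int
  proof
    assume k: "y [^] k \<in> H"
    then have "y [^] (- k) \<in> H"
      using y H by (simp add: int_pow_neg subgroup.m_inv_closed)
    with k have "y [^] (int (nat \<bar>k\<bar>)) \<in> H" by (cases "k \<ge> 0") auto
    from noexp[OF this] show "int 0 dvd k" by simp
  next
    assume "int 0 dvd k" then show "y [^] k \<in> H" using H by (simp add: subgroup.one_closed)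
  qed
  with that show ?thesis by blast
next
  case True
  define n where "n = (LEAST n::nat. n > 0 \<and> y [^] (int n) \<in> H)"
  have n: "n > 0" "y [^] (int n) \<in> H"
    unfolding n_def using LeastI_ex[OF True] by auto
  have least: "\<And>m. m > 0 \<Longrightarrow> y [^] (int m) \<in> H \<Longrightarrow> n \<le> m"
    unfolding n_def by (rule Least_le) auto
  have mult: "y [^] (int n * q) \<in> H" for q
    using subgroup_int_pow_closed[OF H n(2), of q] y by (simp add: int_pow_pow)
  have "int n dvd k" if k: "y [^] k \<in> H" for k
  proof -
    have "y [^] (k - int n * (k div int n)) \<in> H"
      using k mult y H by (simp add: int_pow_diff subgroup.m_closed subgroup.m_inv_closed)
    then have "y [^] (int (nat (k mod int n))) \<in> H"
      using n(1) by (simp add: minus_mult_div_eq_mod)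
    moreover have "nat (k mod int n) < n" using n(1)
      by (metis nat_less_iff of_nat_0_less_iff pos_mod_bound pos_mod_sign)
    ultimately have "nat (k mod int n) = 0" using least by (meson leD neq0_conv)
    then show ?thesis using n(1)
      by (metis dvd_eq_mod_eq_0 nat_0_iff of_nat_0_less_iff order_antisym pos_mod_sign)
  qed
  then show ?thesis using mult by (intro that[of n]) (auto elim!: dvdE)
qed

text \<open>
  A homomorphism defined on a subgroup of \<open>G\<close> is encoded by its graph. A subgroup of the product is
  the graph of a map as soon as it meets the second factor trivially, and graphs are directly
  ordered by inclusion, as Zorn's lemma requires.
\<close>

definition partial_hom :: "('a, 'm) monoid_scheme \<Rightarrow> ('d, 'n) monoid_scheme \<Rightarrow> ('a \<times> 'd) set \<Rightarrow> bool"
  where "partial_hom G D \<Gamma> \<longleftrightarrow>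
    subgroup \<Gamma> (G \<times>\<times> D) \<and> (\<forall>t. (\<one>\<^bsub>G\<^esub>, t) \<in> \<Gamma> \<longrightarrow> t = \<one>\<^bsub>D\<^esub>)"

lemma fst_snd_hom_DirProd:
  "fst \<in> hom (G \<times>\<times> D) G" "snd \<in> hom (G \<times>\<times> D) D"
  by (auto simp: hom_def)

lemma int_pow_DirProd:
  assumes "group G" "group D" "y \<in> carrier G" "w \<in> carrier D"
  shows "(y, w) [^]\<^bsub>G \<times>\<times> D\<^esub> (k::int) = (y [^]\<^bsub>G\<^esub> k, w [^]\<^bsub>D\<^esub> k)"
proof -
  have "fst ((y, w) [^]\<^bsub>G \<times>\<times> D\<^esub> k) = y [^]\<^bsub>G\<^esub> k"
    using hom_int_pow[of fst "G \<times>\<times> D" G "(y,w)" k] assms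
    by (simp add: DirProd_group fst_snd_hom_DirProd)
  moreover have "snd ((y, w) [^]\<^bsub>G \<times>\<times> D\<^esub> k) = w [^]\<^bsub>D\<^esub> k"
    using hom_int_pow[of snd "G \<times>\<times> D" D "(y,w)" k] assms
    by (simp add: DirProd_group fst_snd_hom_DirProd)
  ultimately show ?thesis by (metis prod.collapse)
qed

lemma DirProd_comm_group:
  assumes "comm_group G" "comm_group D"
  shows "comm_group (G \<times>\<times> D)"
proof -
  interpret G: comm_group G by fact
  interpret D: comm_group D by fact
  interpret GD: group "G \<times>\<times> D" using DirProd_group G.is_group D.is_group by blast
  show ?thesis
    by (rule GD.group_comm_groupI) (auto simp: mult_DirProd' G.m_comm D.m_comm)
qed

lemma partial_hom_unique:
  assumes "group G" "group D" "partial_hom G D \<Gamma>" "(a, s) \<in> \<Gamma>" "(a, t) \<in> \<Gamma>"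
  shows "s = t"
proof -
  interpret G: group G by fact
  interpret D: group D by fact
  have S: "subgroup \<Gamma> (G \<times>\<times> D)" using assms(3) by (simp add: partial_hom_def)
  have mem: "a \<in> carrier G" "s \<in> carrier D" "t \<in> carrier D"
    using subgroup.subset[OF S] assms by auto
  have "(a, s) \<otimes>\<^bsub>G \<times>\<times> D\<^esub> inv\<^bsub>G \<times>\<times> D\<^esub> (a, t) \<in> \<Gamma>"
    using S assms by (simp add: subgroup.m_closed subgroup.m_inv_closed)
  then have "(\<one>\<^bsub>G\<^esub>, s \<otimes>\<^bsub>D\<^esub> inv\<^bsub>D\<^esub> t) \<in> \<Gamma>"
    using mem assms by simp
  then have "s \<otimes>\<^bsub>D\<^esub> inv\<^bsub>D\<^esub> t = \<one>\<^bsub>D\<^esub>" using assms(3) by (simp add: partial_hom_def)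
  then show ?thesis using mem by (metis D.inv_equality D.inv_inv D.inv_closed)
qed

text \<open>
  The new graph is generated by the old one and \<open>(y, w)\<close>. An element of it over the identity comes
  from \<open>(a, b)\<close> in the old graph with \<open>a\<close> a power of \<open>y\<close>, and compatibility says that \<open>b\<close> is
  cancelled by the corresponding power of \<open>w\<close>.
\<close>

lemma partial_hom_adjoin:
  assumes "comm_group G" "comm_group D" and \<Gamma>: "partial_hom G D \<Gamma>"
    and y: "y \<in> carrier G" and w: "w \<in> carrier D"
    and compat: "\<And>(k::int) t. (y [^]\<^bsub>G\<^esub> k, t) \<in> \<Gamma> \<Longrightarrow> t = w [^]\<^bsub>D\<^esub> k"
  shows "\<exists>\<Gamma>'. partial_hom G D \<Gamma>' \<and> \<Gamma> \<subseteq> \<Gamma>' \<and> (y, w) \<in> \<Gamma>'"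
proof -
  interpret G: comm_group G by fact
  interpret D: comm_group D by fact
  interpret GD: comm_group "G \<times>\<times> D" using DirProd_comm_group assms by blast
  have S: "subgroup \<Gamma> (G \<times>\<times> D)" using \<Gamma> by (simp add: partial_hom_def)
  have yw: "(y, w) \<in> carrier (G \<times>\<times> D)" using y w by simp
  define \<Gamma>' where "\<Gamma>' = \<Gamma> <#>\<^bsub>G \<times>\<times> D\<^esub> generate (G \<times>\<times> D) {(y, w)}"
  have gen: "generate (G \<times>\<times> D) {(y, w)} = {(y [^]\<^bsub>G\<^esub> k, w [^]\<^bsub>D\<^esub> k) | k::int. True}"
    using GD.generate_pow[OF yw] int_pow_DirProd[OF G.is_group D.is_group y w] by auto
  have S': "subgroup \<Gamma>' (G \<times>\<times> D)"
    unfolding \<Gamma>'_def using S yw by (intro GD.mult_subgroups GD.generate_is_subgroup) auto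
  have mem: "z \<in> \<Gamma>' \<longleftrightarrow> (\<exists>a b k. (a, b) \<in> \<Gamma> \<and>
      z = (a \<otimes>\<^bsub>G\<^esub> y [^]\<^bsub>G\<^esub> (k::int), b \<otimes>\<^bsub>D\<^esub> w [^]\<^bsub>D\<^esub> k))" for z
    unfolding \<Gamma>'_def gen set_mult_def by force
  have "t = \<one>\<^bsub>D\<^esub>" if "(\<one>\<^bsub>G\<^esub>, t) \<in> \<Gamma>'" for t
  proof -
    from that mem obtain a b k where ab: "(a, b) \<in> \<Gamma>"
      and e: "\<one>\<^bsub>G\<^esub> = a \<otimes>\<^bsub>G\<^esub> y [^]\<^bsub>G\<^esub> (k::int)" "t = b \<otimes>\<^bsub>D\<^esub> w [^]\<^bsub>D\<^esub> k"
      by auto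
    have c: "a \<in> carrier G" "b \<in> carrier D" using subgroup.subset[OF S] ab by auto
    have "a = y [^]\<^bsub>G\<^esub> (- k)"
      using e(1) c y by (metis G.int_pow_closed G.int_pow_neg G.inv_equality)
    then have "b = w [^]\<^bsub>D\<^esub> (- k)" using compat ab by blast
    then show ?thesis using e(2) w by (simp add: D.int_pow_neg)
  qed
  then have "partial_hom G D \<Gamma>'" using S' by (simp add: partial_hom_def)
  moreover have "\<Gamma> \<subseteq> \<Gamma>'"
  proof
    fix z assume z: "z \<in> \<Gamma>"
    then obtain a b where ab: "z = (a, b)" "a \<in> carrier G" "b \<in> carrier D"
      using subgroup.subset[OF S] by (cases z) auto
    with z show "z \<in> \<Gamma>'" unfolding mem
      by (intro exI[of _ a] exI[of _ b] exI[of _ 0]) auto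
  qed
  moreover have "(y, w) \<in> \<Gamma>'" unfolding mem
    using S subgroup.one_closed[OF S] y w
    by (intro exI[of _ "\<one>\<^bsub>G\<^esub>"] exI[of _ "\<one>\<^bsub>D\<^esub>"] exI[of _ 1]) auto
  ultimately show ?thesis by blast
qed

lemma partial_hom_domain:
  assumes "group G" "group D" "partial_hom G D \<Gamma>"
  shows "subgroup (fst ` \<Gamma>) G"
proof -
  interpret G: group G by fact
  interpret D: group D by fact
  have S: "subgroup \<Gamma> (G \<times>\<times> D)" using assms(3) by (simp add: partial_hom_def)
  interpret f: group_hom "G \<times>\<times> D" G fst
    using assms by (simp add: group_hom_def group_hom_axioms_def DirProd_group fst_snd_hom_DirProd)
  show ?thesis using f.subgroup_img_is_subgroup[OF S] .
qed

text \<open>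
  The only constraint on the value \<open>w\<close> at \<open>y\<close> is \<open>w\<^sup>n = z\<close>, where \<open>n\<close> generates the exponents of the
  powers of \<open>y\<close> in the domain and \<open>z\<close> is the value already prescribed at \<open>y\<^sup>n\<close>. Divisibility
  solves this equation when \<open>n > 0\<close>, and \<open>z\<close> is the identity when \<open>n = 0\<close>.
\<close>

lemma partial_hom_extends_to_element:
  assumes "comm_group G" "comm_group D" and \<Gamma>: "partial_hom G D \<Gamma>"
    and divisible: "\<And>z n. z \<in> carrier D \<Longrightarrow> 0 < n \<Longrightarrow> \<exists>w\<in>carrier D. w [^]\<^bsub>D\<^esub> (n::nat) = z"
    and y: "y \<in> carrier G"
  shows "\<exists>w \<Gamma>'. partial_hom G D \<Gamma>' \<and> \<Gamma> \<subseteq> \<Gamma>' \<and> (y, w) \<in> \<Gamma>'"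
proof -
  interpret G: comm_group G by fact
  interpret D: comm_group D by fact
  have S: "subgroup \<Gamma> (G \<times>\<times> D)" using \<Gamma> by (simp add: partial_hom_def)
  have gr: "group G" "group D" by unfold_locales
  obtain n where n: "\<And>k::int. y [^]\<^bsub>G\<^esub> k \<in> fst ` \<Gamma> \<longleftrightarrow> int n dvd k"
    using G.exponents_into_subgroup[OF partial_hom_domain[OF gr \<Gamma>] y] by blast
  have "y [^]\<^bsub>G\<^esub> (int n) \<in> fst ` \<Gamma>" by (simp add: n)
  then obtain z where z: "(y [^]\<^bsub>G\<^esub> (int n), z) \<in> \<Gamma>" by (elim imageE) (metis prod.collapse)
  then have zD: "z \<in> carrier D" using subgroup.subset[OF S] by auto
  have "\<exists>w\<in>carrier D. w [^]\<^bsub>D\<^esub> n = z"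
  proof (cases "n = 0")
    case True
    then have "z = \<one>\<^bsub>D\<^esub>" using z \<Gamma> by (simp add: partial_hom_def)
    then show ?thesis using True by auto
  qed (use divisible zD in auto)
  then obtain w where w: "w \<in> carrier D" "w [^]\<^bsub>D\<^esub> (int n) = z" by (auto simp: int_pow_int)
  have "t = w [^]\<^bsub>D\<^esub> k" if t: "(y [^]\<^bsub>G\<^esub> k, t) \<in> \<Gamma>" for k :: int and t
  proof -
    have "y [^]\<^bsub>G\<^esub> k \<in> fst ` \<Gamma>" using image_eqI[OF _ t, of _ fst] by simp
    then have "int n dvd k" by (simp add: n)
    then obtain q where q: "k = int n * q" by blast
    interpret GD: group "G \<times>\<times> D" using DirProd_group gr by blast
    have "(y [^]\<^bsub>G\<^esub> (int n), z) [^]\<^bsub>G \<times>\<times> D\<^esub> q \<in> \<Gamma>"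
      using GD.subgroup_int_pow_closed[OF S z] .
    then have "(y [^]\<^bsub>G\<^esub> k, w [^]\<^bsub>D\<^esub> k) \<in> \<Gamma>"
      using int_pow_DirProd[OF gr] y zD w q by (metis G.int_pow_closed G.int_pow_pow D.int_pow_pow)
    then show ?thesis using partial_hom_unique[OF gr \<Gamma> t] by blast
  qed
  then show ?thesis using partial_hom_adjoin[OF assms(1,2) \<Gamma> y w(1)] by blast
qed

text \<open>
  Divisible groups are injective: a maximal graph is total, because otherwise it would extend to
  one more element.
\<close>

lemma partial_hom_extends:
  assumes "comm_group G" "comm_group D" and \<Gamma>: "partial_hom G D \<Gamma>"
    and divisible: "\<And>z n. z \<in> carrier D \<Longrightarrow> 0 < n \<Longrightarrow> \<exists>w\<in>carrier D. w [^]\<^bsub>D\<^esub> (n::nat) = z"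
  shows "\<exists>\<xi>\<in>hom G D. \<forall>x t. (x, t) \<in> \<Gamma> \<longrightarrow> \<xi> x = t"
proof -
  interpret G: comm_group G by fact
  interpret D: comm_group D by fact
  have gr: "group G" "group D" by unfold_locales
  let ?A = "{\<Delta>. partial_hom G D \<Delta> \<and> \<Gamma> \<subseteq> \<Delta>}"
  have "\<exists>M\<in>?A. \<forall>X\<in>?A. M \<subseteq> X \<longrightarrow> X = M"
  proof (rule subset_Zorn_nonempty)
    show "?A \<noteq> {}" using \<Gamma> by blast
  next
    fix C assume C0: "C \<noteq> {}" and chain: "subset.chain ?A C"
    have C: "\<And>X. X \<in> C \<Longrightarrow> subgroup X (G \<times>\<times> D)" "\<And>X. X \<in> C \<Longrightarrow> partial_hom G D X"
      using chain by (auto simp: subset.chain_def partial_hom_def)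
    have "subgroup (\<Union>C) (G \<times>\<times> D)"
    proof (rule subgroup.intro)
      show "\<Union>C \<subseteq> carrier (G \<times>\<times> D)" using C(1) subgroup.subset by blast
      show "\<one>\<^bsub>G \<times>\<times> D\<^esub> \<in> \<Union>C" using C0 C(1) subgroup.one_closed by blast
      show "inv\<^bsub>G \<times>\<times> D\<^esub> x \<in> \<Union>C" if "x \<in> \<Union>C" for x
        using that subgroup.m_inv_closed[OF C(1)] by (meson UnionE UnionI)
      fix x y assume "x \<in> \<Union>C" "y \<in> \<Union>C"
      then obtain X Y where XY: "X \<in> C" "x \<in> X" "Y \<in> C" "y \<in> Y" by blast
      then have "X \<subseteq> Y \<or> Y \<subseteq> X" using chain by (meson subset_chain_def)
      then obtain Z where Z: "Z \<in> C" "x \<in> Z" "y \<in> Z" using XY by blast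
      show "x \<otimes>\<^bsub>G \<times>\<times> D\<^esub> y \<in> \<Union>C"
        using UnionI[OF Z(1)] subgroup.m_closed[OF C(1)[OF Z(1)] Z(2,3)] by blast
    qed
    moreover have "\<Gamma> \<subseteq> \<Union>C"
    proof -
      from C0 obtain X where "X \<in> C" by blast
      then show ?thesis using chain by (auto simp: subset_chain_def)
    qed
    ultimately show "\<Union>C \<in> ?A" using C(2) by (auto simp: partial_hom_def)
  qed
  then obtain M where "M \<in> ?A" and mx: "\<forall>X\<in>?A. M \<subseteq> X \<longrightarrow> X = M" by (rule bexE)
  then have M: "partial_hom G D M" "\<Gamma> \<subseteq> M" by auto
  have max: "X = M" if "partial_hom G D X" "M \<subseteq> X" for X
    using mx[rule_format, OF _ that(2)] that M(2) by simp
  have total: "\<exists>w. (y, w) \<in> M" if "y \<in> carrier G" for y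
    using partial_hom_extends_to_element[OF assms(1,2) M(1) divisible that] max by metis
  define \<xi> where "\<xi> y = (THE w. (y, w) \<in> M)" for y
  have \<xi>: "\<xi> y = w" if "(y, w) \<in> M" for y w
    unfolding \<xi>_def using that partial_hom_unique[OF gr M(1)] by blast
  have S: "subgroup M (G \<times>\<times> D)" using M(1) by (simp add: partial_hom_def)
  have "\<xi> \<in> hom G D"
  proof (rule homI)
    fix x assume "x \<in> carrier G"
    then obtain s where "(x, s) \<in> M" using total by blast
    then show "\<xi> x \<in> carrier D" using \<xi> subgroup.subset[OF S] by auto
    fix y assume "y \<in> carrier G"
    then obtain t where "(y, t) \<in> M" using total by blast
    then have "(x \<otimes>\<^bsub>G\<^esub> y, s \<otimes>\<^bsub>D\<^esub> t) \<in> M"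
      using subgroup.m_closed[OF S \<open>(x, s) \<in> M\<close> \<open>(y, t) \<in> M\<close>] by simp
    then show "\<xi> (x \<otimes>\<^bsub>G\<^esub> y) = \<xi> x \<otimes>\<^bsub>D\<^esub> \<xi> y"
      using \<xi> \<open>(x, s) \<in> M\<close> \<open>(y, t) \<in> M\<close> by metis
  qed
  then show ?thesis using \<xi> M(2) by blast
qed

section \<open>The circle group\<close>

lemma circle_group_simps [simp]:
  "carrier circle_group = sphere 0 1" "\<one>\<^bsub>circle_group\<^esub> = 1" "x \<otimes>\<^bsub>circle_group\<^esub> y = x * y"
  by (simp_all add: circle_group_def)

lemma circle_group_comm_group: "comm_group circle_group"
proof (rule comm_groupI)
  fix x assume x: "x \<in> carrier circle_group"
  then have "inverse x * x = 1" "inverse x \<in> carrier circle_group" by (auto simp: norm_inverse intro!: left_inverse)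
  then show "\<exists>y\<in>carrier circle_group. y \<otimes>\<^bsub>circle_group\<^esub> x = \<one>\<^bsub>circle_group\<^esub>" by auto
qed (auto simp: norm_mult)

lemma circle_group_nat_pow [simp]: "z [^]\<^bsub>circle_group\<^esub> (n::nat) = z ^ n"
  by (induction n) (auto simp: nat_pow_def circle_group_def mult.commute)

lemma circle_group_divisible:
  assumes "z \<in> carrier circle_group" "0 < n"
  shows "\<exists>w\<in>carrier circle_group. w [^]\<^bsub>circle_group\<^esub> (n::nat) = z"
proof -
  have "cmod z = 1" using assms by simp
  then have "cis (Arg z) = z" by (cases "z = 0") (auto simp: cis_Arg sgn_eq)
  then have "cis (Arg z / n) ^ n = z"
    using assms(2) by (simp only: Complex.DeMoivre) simp
  then show ?thesis by (intro bexI[of _ "cis (Arg z / n)"]) auto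
qed

text \<open>
  The case \<open>n = 0\<close> is included, where every point of the circle other than 1 qualifies; it
  corresponds to an element of infinite order.
\<close>

lemma nontrivial_root_of_unity:
  assumes "n \<noteq> 1"
  shows "\<exists>w. cmod w = 1 \<and> w \<noteq> 1 \<and> w ^ n = 1"
proof (cases "n = 0")
  case True then show ?thesis by (intro exI[of _ "-1"]) auto
next
  case False
  with assms have n: "n > 1" by simp
  have "cis (2 * pi / n) \<noteq> 1"
  proof
    assume "cis (2 * pi / n) = 1"
    then have "cos (2 * pi / n) = 1" by (metis cis.simps(1) one_complex.simps(1))
    then obtain m :: int where "2 * pi / n = m * 2 * pi" unfolding cos_one_2pi_int by (auto simp: mult.assoc)
    then have "1 = real_of_int m * real n" using n by (simp add: field_simps)
    then have "1 = m * int n" by (metis of_int_eq_1_iff of_int_mult of_int_of_nat_eq)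
    then have "int n dvd 1" by (metis dvd_triv_right)
    then show False using n by simp
  qed
  moreover have "cis (2 * pi / n) ^ n = 1" using n by (simp only: Complex.DeMoivre) simp
  ultimately show ?thesis by (intro exI[of _ "cis (2 * pi / n)"]) auto
qed

text \<open>
  Squaring moves a point near 1 away from 1 by a factor of at least \<open>3/2\<close>, since
  \<open>u\<^sup>2 - 1 = (u + 1) (u - 1)\<close> and \<open>u + 1\<close> is near 2. So the powers of a point other than 1
  cannot all stay near 1. This is what makes characters near the trivial one trivial on subgroups.
\<close>

lemma circle_no_small_subgroups:
  assumes z: "cmod z = 1" and small: "\<And>n::nat. cmod (z ^ n - 1) < 1 / 2"
  shows "z = 1"
proof (rule ccontr)
  assume "z \<noteq> 1"
  have growth: "(3/2) ^ n * cmod (z - 1) \<le> cmod (z ^ (2 ^ n) - 1)" for n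
  proof (induction n)
    case (Suc n)
    let ?u = "z ^ (2 ^ n)"
    have "cmod (?u + 1) \<ge> 2 - cmod (?u - 1)"
      using norm_triangle_ineq[of "?u + 1" "- (?u - 1)"] by (simp add: norm_minus_commute)
    then have "3/2 \<le> cmod (?u + 1)" using small[of "2 ^ n"] by linarith
    then have "(3/2) * ((3/2) ^ n * cmod (z - 1)) \<le> cmod (?u + 1) * cmod (?u - 1)"
      using Suc by (intro mult_mono) auto
    also have "\<dots> = cmod ((?u + 1) * (?u - 1))" by (simp add: norm_mult)
    also have "(?u + 1) * (?u - 1) = z ^ (2 ^ Suc n) - 1"
      by (simp add: algebra_simps power_mult power2_eq_square flip: power_add)
    finally show ?case by simp
  qed simp
  obtain n where "1 / cmod (z - 1) < (3/2) ^ n" using real_arch_pow[of "3/2"] by auto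
  then have "1 < (3/2) ^ n * cmod (z - 1)" using \<open>z \<noteq> 1\<close> by (simp add: field_simps)
  then show False using growth[of n] small[of "2 ^ n"] by linarith
qed

text \<open>
  Let \<open>n\<close> generate the exponents of the powers of \<open>x\<close> in \<open>M\<close>. Since \<open>x \<notin> M\<close>, \<open>n\<close> is not 1, and some
  \<open>w \<noteq> 1\<close> on the circle has \<open>w\<^sup>n = 1\<close>. Prescribing 1 on \<open>M\<close> and \<open>w\<close> at \<open>x\<close> is then consistent, and the
  circle is divisible, so this character of the subgroup generated by \<open>M\<close> and \<open>x\<close> extends to \<open>G\<close>.
\<close>

lemma character_separates_subgroup:
  assumes "comm_group G" and M: "subgroup M G" and x: "x \<in> carrier G" "x \<notin> M"
  shows "\<exists>\<xi>\<in>hom G circle_group. (\<forall>m\<in>M. \<xi> m = 1) \<and> \<xi> x \<noteq> 1"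
proof -
  interpret G: comm_group G by fact
  interpret C: comm_group circle_group by (rule circle_group_comm_group)
  have gr: "group G" "group circle_group" by unfold_locales
  let ?\<Gamma> = "M \<times> {1::complex}"
  have "subgroup ?\<Gamma> (G \<times>\<times> circle_group)"
    using DirProd_subgroups[OF gr(1) M gr(2) C.triv_subgroup] by simp
  then have \<Gamma>: "partial_hom G circle_group ?\<Gamma>" by (auto simp: partial_hom_def)
  obtain n where n: "\<And>k::int. x [^]\<^bsub>G\<^esub> k \<in> M \<longleftrightarrow> int n dvd k"
    using G.exponents_into_subgroup[OF M x(1)] by blast
  have "n \<noteq> 1" using n[of 1] x by auto
  then obtain w where w: "cmod w = 1" "w \<noteq> 1" "w ^ n = 1" using nontrivial_root_of_unity by blast
  have wpow: "w [^]\<^bsub>circle_group\<^esub> (int n * q) = 1" for q :: int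
    using C.int_pow_pow[of w "int n" q] w by (simp add: int_pow_int C.int_pow_one[simplified])
  have "t = w [^]\<^bsub>circle_group\<^esub> k" if "(x [^]\<^bsub>G\<^esub> k, t) \<in> ?\<Gamma>" for k :: int and t
    using that n wpow by (auto elim!: dvdE)
  then obtain \<Gamma>' where \<Gamma>': "partial_hom G circle_group \<Gamma>'" "?\<Gamma> \<subseteq> \<Gamma>'" "(x, w) \<in> \<Gamma>'"
    using partial_hom_adjoin[OF assms(1) circle_group_comm_group \<Gamma> x(1), of w] w by auto
  obtain \<xi> where \<xi>: "\<xi> \<in> hom G circle_group" "\<And>y t. (y, t) \<in> \<Gamma>' \<Longrightarrow> \<xi> y = t"
    using partial_hom_extends[OF assms(1) circle_group_comm_group \<Gamma>'(1) circle_group_divisible]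
    by auto
  have "\<xi> m = 1" if "m \<in> M" for m
    using \<xi>(2)[of m 1] \<Gamma>'(2) that by auto
  moreover have "\<xi> x \<noteq> 1" using \<xi>(2)[OF \<Gamma>'(3)] w(2) by simp
  ultimately show ?thesis using \<xi>(1) by blast
qed

section \<open>Indices and pairings\<close>

text \<open>
  Translating the summation variable by \<open>a\<close> multiplies the sum by the value at \<open>a\<close>. So the sum
  vanishes as soon as one value differs from 1. An infinite \<open>Q\<close> is covered because its order and
  sums over it are 0.
\<close>

lemma sum_character:
  fixes \<xi> :: "'a \<Rightarrow> complex"
  assumes "group Q"
    and mult: "\<And>x y. x \<in> carrier Q \<Longrightarrow> y \<in> carrier Q \<Longrightarrow> \<xi> (x \<otimes>\<^bsub>Q\<^esub> y) = \<xi> x * \<xi> y"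
  shows "(\<Sum>x\<in>carrier Q. \<xi> x) = (if \<forall>x\<in>carrier Q. \<xi> x = 1 then of_nat (order Q) else 0)"
proof (cases "\<forall>x\<in>carrier Q. \<xi> x = 1")
  case True then show ?thesis by (simp add: order_def)
next
  case False
  interpret Q: group Q by fact
  from False obtain a where a: "a \<in> carrier Q" "\<xi> a \<noteq> 1" by blast
  have "(\<Sum>x\<in>carrier Q. \<xi> x) = (\<Sum>x\<in>carrier Q. \<xi> (a \<otimes>\<^bsub>Q\<^esub> x))"
    by (rule sum.reindex_bij_witness[of _ "\<lambda>x. a \<otimes>\<^bsub>Q\<^esub> x" "\<lambda>x. inv\<^bsub>Q\<^esub> a \<otimes>\<^bsub>Q\<^esub> x"])
      (use a in \<open>auto simp flip: Q.m_assoc\<close>)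
  also have "\<dots> = \<xi> a * (\<Sum>x\<in>carrier Q. \<xi> x)"
    using a mult by (simp add: sum_distrib_left)
  finally have "(1 - \<xi> a) * (\<Sum>x\<in>carrier Q. \<xi> x) = 0" by (simp add: algebra_simps)
  then show ?thesis using a False by auto
qed

text \<open>
  The sum of \<open>f\<close> over \<open>Q \<times> P\<close> is computed in both orders. By the previous lemma, summing first over
  \<open>P\<close> leaves only the identity of \<open>Q\<close> and gives \<open>order P\<close>, and summing first over \<open>Q\<close> gives
  \<open>order Q\<close>. This replaces the classification of finite abelian groups in the proof that a finite
  abelian group and its dual have the same order.
\<close>

lemma perfect_pairing_order_eq:
  fixes f :: "'q \<Rightarrow> 'p \<Rightarrow> complex"
  assumes "group P" "group Q" and fin: "finite (carrier P)"
    and multl: "\<And>x y p. x \<in> carrier Q \<Longrightarrow> y \<in> carrier Q \<Longrightarrow> p \<in> carrier P \<Longrightarrow>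
                  f (x \<otimes>\<^bsub>Q\<^esub> y) p = f x p * f y p"
    and multr: "\<And>x p q. x \<in> carrier Q \<Longrightarrow> p \<in> carrier P \<Longrightarrow> q \<in> carrier P \<Longrightarrow>
                  f x (p \<otimes>\<^bsub>P\<^esub> q) = f x p * f x q"
    and nz: "\<And>x p. x \<in> carrier Q \<Longrightarrow> p \<in> carrier P \<Longrightarrow> f x p \<noteq> 0"
    and kerl: "\<And>x. x \<in> carrier Q \<Longrightarrow> (\<forall>p\<in>carrier P. f x p = 1) \<Longrightarrow> x = \<one>\<^bsub>Q\<^esub>"
    and kerr: "\<And>p. p \<in> carrier P \<Longrightarrow> (\<forall>x\<in>carrier Q. f x p = 1) \<Longrightarrow> p = \<one>\<^bsub>P\<^esub>"
  shows "order P = order Q"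
proof -
  interpret P: group P by fact
  interpret Q: group Q by fact
  have f1: "f x \<one>\<^bsub>P\<^esub> = 1" if "x \<in> carrier Q" for x
    using multr[OF that, of "\<one>\<^bsub>P\<^esub>" "\<one>\<^bsub>P\<^esub>"] nz[OF that] by simp
  have g1: "f \<one>\<^bsub>Q\<^esub> p = 1" if "p \<in> carrier P" for p
    using multl[of "\<one>\<^bsub>Q\<^esub>" "\<one>\<^bsub>Q\<^esub>" p] nz[of "\<one>\<^bsub>Q\<^esub>" p] that by simp
  have pow: "f x (p [^]\<^bsub>P\<^esub> (n::nat)) = f x p ^ n" if "x \<in> carrier Q" "p \<in> carrier P" for x p n
    using that by (induction n) (simp_all add: f1 multr mult.commute)
  have root: "f x p ^ order P = 1" if "x \<in> carrier Q" "p \<in> carrier P" for x p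
    using pow[OF that, of "order P"] P.pow_order_eq_1[OF that(2)] f1 that by simp
  \<comment> \<open>An element of \<open>Q\<close> is determined by its values, which are roots of unity of order \<open>order P\<close>.\<close>
  have "finite (carrier Q)"
  proof (rule inj_on_finite)
    let ?R = "{z::complex. z ^ order P = 1}"
    show "inj_on (\<lambda>x. \<lambda>p\<in>carrier P. f x p) (carrier Q)"
    proof (rule inj_onI)
      fix x y assume xy: "x \<in> carrier Q" "y \<in> carrier Q"
        and eq: "(\<lambda>p\<in>carrier P. f x p) = (\<lambda>p\<in>carrier P. f y p)"
      have "f (x \<otimes>\<^bsub>Q\<^esub> inv\<^bsub>Q\<^esub> y) p = 1" if p: "p \<in> carrier P" for p
      proof -
        have "f x p = f y p" using eq p by (metis restrict_apply')
        then have "f (x \<otimes>\<^bsub>Q\<^esub> inv\<^bsub>Q\<^esub> y) p = f (y \<otimes>\<^bsub>Q\<^esub> inv\<^bsub>Q\<^esub> y) p"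
          using xy p by (simp only: multl Q.inv_closed)
        then show ?thesis using xy p g1 by simp
      qed
      then have "x \<otimes>\<^bsub>Q\<^esub> inv\<^bsub>Q\<^esub> y = \<one>\<^bsub>Q\<^esub>" using kerl xy by simp
      then show "x = y" using xy by (metis Q.inv_closed Q.inv_equality Q.inv_inv)
    qed
    show "(\<lambda>x. \<lambda>p\<in>carrier P. f x p) ` carrier Q \<subseteq> (carrier P \<rightarrow>\<^sub>E ?R)" using root by auto
    have "finite ?R" using fin P.order_gt_0_iff_finite
      by (intro finite_roots_unity) (metis One_nat_def Suc_leI)
    then show "finite (carrier P \<rightarrow>\<^sub>E ?R)" using fin by (intro finite_PiE)
  qed
  have triv1: "(\<forall>p\<in>carrier P. f x p = 1) \<longleftrightarrow> x = \<one>\<^bsub>Q\<^esub>" if "x \<in> carrier Q" for x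
    using that kerl g1 by blast
  have triv2: "(\<forall>x\<in>carrier Q. f x p = 1) \<longleftrightarrow> p = \<one>\<^bsub>P\<^esub>" if "p \<in> carrier P" for p
    using that kerr f1 by blast
  have "(\<Sum>x\<in>carrier Q. \<Sum>p\<in>carrier P. f x p)
      = (\<Sum>x\<in>carrier Q. if x = \<one>\<^bsub>Q\<^esub> then of_nat (order P) else 0)"
    by (rule sum.cong) (simp_all add: sum_character[OF assms(1)] multr triv1)
  moreover have "(\<Sum>p\<in>carrier P. \<Sum>x\<in>carrier Q. f x p)
      = (\<Sum>p\<in>carrier P. if p = \<one>\<^bsub>P\<^esub> then of_nat (order Q) else 0)"
    by (rule sum.cong) (simp_all add: sum_character[OF assms(2), where \<xi> = "\<lambda>x. f x _"] multl triv2)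
  ultimately have "(of_nat (order P) :: complex) = of_nat (order Q)"
    using fin \<open>finite (carrier Q)\<close> sum.swap[of f "carrier P" "carrier Q"]
    by (simp add: sum.delta')
  then show ?thesis by simp
qed

text \<open>
  The pairing descends to a perfect pairing between the quotients by the two kernels. This is the
  only source of index computations below: it turns an index in the dual group into an index
  in \<open>G\<close>.
\<close>

lemma pairing_index_eq:
  fixes f :: "'q \<Rightarrow> 'p \<Rightarrow> complex"
  assumes "comm_group P" "comm_group Q"
    and multl: "\<And>x y p. x \<in> carrier Q \<Longrightarrow> y \<in> carrier Q \<Longrightarrow> p \<in> carrier P \<Longrightarrow>
                  f (x \<otimes>\<^bsub>Q\<^esub> y) p = f x p * f y p"
    and multr: "\<And>x p q. x \<in> carrier Q \<Longrightarrow> p \<in> carrier P \<Longrightarrow> q \<in> carrier P \<Longrightarrow>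
                  f x (p \<otimes>\<^bsub>P\<^esub> q) = f x p * f x q"
    and nz: "\<And>x p. x \<in> carrier Q \<Longrightarrow> p \<in> carrier P \<Longrightarrow> f x p \<noteq> 0"
    and A: "A = {p \<in> carrier P. \<forall>x\<in>carrier Q. f x p = 1}"
    and C: "C = {x \<in> carrier Q. \<forall>p\<in>carrier P. f x p = 1}"
    and fin: "finite (rcosets\<^bsub>P\<^esub> A)"
  shows "card (rcosets\<^bsub>P\<^esub> A) = card (rcosets\<^bsub>Q\<^esub> C)"
proof -
  interpret P: comm_group P by fact
  interpret Q: comm_group Q by fact
  have f1: "f x \<one>\<^bsub>P\<^esub> = 1" if "x \<in> carrier Q" for x
    using multr[OF that, of "\<one>\<^bsub>P\<^esub>" "\<one>\<^bsub>P\<^esub>"] nz[OF that] by simp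
  have g1: "f \<one>\<^bsub>Q\<^esub> p = 1" if "p \<in> carrier P" for p
    using multl[of "\<one>\<^bsub>Q\<^esub>" "\<one>\<^bsub>Q\<^esub>" p] nz[of "\<one>\<^bsub>Q\<^esub>" p] that by simp
  have invr: "f x (inv\<^bsub>P\<^esub> p) = inverse (f x p)" if "x \<in> carrier Q" "p \<in> carrier P" for x p
    using multr[of x "inv\<^bsub>P\<^esub> p" p] that f1 nz by (simp add: inverse_unique field_simps)
  have invl: "f (inv\<^bsub>Q\<^esub> x) p = inverse (f x p)" if "x \<in> carrier Q" "p \<in> carrier P" for x p
    using multl[of "inv\<^bsub>Q\<^esub> x" x p] that g1 nz by (simp add: inverse_unique field_simps)
  have subA: "subgroup A P"
    unfolding A by (rule P.subgroupI) (auto simp: multr invr intro: f1)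
  have subC: "subgroup C Q"
    unfolding C by (rule Q.subgroupI) (auto simp: multl invl intro: g1)
  interpret A: normal A P using P.subgroup_imp_normal subA .
  interpret C: normal C Q using Q.subgroup_imp_normal subC .
  \<comment> \<open>The induced pairing of cosets, evaluated at arbitrary representatives.\<close>
  define F where "F S R = f (SOME x. x \<in> S) (SOME p. p \<in> R)" for S R
  have F: "F (C #>\<^bsub>Q\<^esub> x) (A #>\<^bsub>P\<^esub> p) = f x p" if xp: "x \<in> carrier Q" "p \<in> carrier P" for x p
  proof -
    have "x \<in> C #>\<^bsub>Q\<^esub> x" "p \<in> A #>\<^bsub>P\<^esub> p"
      using xp P.rcos_self Q.rcos_self subA subC by auto
    then have "(SOME x'. x' \<in> C #>\<^bsub>Q\<^esub> x) \<in> C #>\<^bsub>Q\<^esub> x" "(SOME p'. p' \<in> A #>\<^bsub>P\<^esub> p) \<in> A #>\<^bsub>P\<^esub> p"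
      by (auto intro: someI)
    then obtain c a where c: "c \<in> C" and cx: "(SOME x'. x' \<in> C #>\<^bsub>Q\<^esub> x) = c \<otimes>\<^bsub>Q\<^esub> x"
      and a: "a \<in> A" and ap: "(SOME p'. p' \<in> A #>\<^bsub>P\<^esub> p) = a \<otimes>\<^bsub>P\<^esub> p"
      unfolding r_coset_def by auto
    have "F (C #>\<^bsub>Q\<^esub> x) (A #>\<^bsub>P\<^esub> p) = f c (a \<otimes>\<^bsub>P\<^esub> p) * f x (a \<otimes>\<^bsub>P\<^esub> p)"
      unfolding F_def cx ap using xp C.mem_carrier[OF c] A.mem_carrier[OF a] by (simp add: multl)
    also have "f c (a \<otimes>\<^bsub>P\<^esub> p) = 1" using xp c A.mem_carrier[OF a] unfolding C by simp
    also have "f x (a \<otimes>\<^bsub>P\<^esub> p) = f x a * f x p" using xp A.mem_carrier[OF a] by (simp add: multr)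
    also have "f x a = 1" using a xp unfolding A by simp
    finally show ?thesis by simp
  qed
  have cP: "carrier (P Mod A) = (\<lambda>p. A #>\<^bsub>P\<^esub> p) ` carrier P"
   and cQ: "carrier (Q Mod C) = (\<lambda>x. C #>\<^bsub>Q\<^esub> x) ` carrier Q"
    by (auto simp: FactGroup_def RCOSETS_def)
  have "order (P Mod A) = order (Q Mod C)"
  proof (rule perfect_pairing_order_eq[where f = F])
    show "group (P Mod A)" "group (Q Mod C)"
      by (rule A.factorgroup_is_group C.factorgroup_is_group)+
    show "finite (carrier (P Mod A))" using fin by (simp add: FactGroup_def)
    show "X = \<one>\<^bsub>Q Mod C\<^esub>" if X: "X \<in> carrier (Q Mod C)" "\<forall>p\<in>carrier (P Mod A). F X p = 1" for X
    proof -
      obtain x where x: "x \<in> carrier Q" "X = C #>\<^bsub>Q\<^esub> x" using X cQ by auto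
      have "f x p = 1" if p: "p \<in> carrier P" for p
        using F[OF x(1) p] bspec[OF X(2), of "A #>\<^bsub>P\<^esub> p"] p by (simp add: cP x(2))
      then have "x \<in> C" using x(1) unfolding C by simp
      then show ?thesis using x(2) Q.coset_join2[OF x(1) subC] by (simp add: FactGroup_def)
    qed
    show "R = \<one>\<^bsub>P Mod A\<^esub>" if R: "R \<in> carrier (P Mod A)" "\<forall>x\<in>carrier (Q Mod C). F x R = 1" for R
    proof -
      obtain p where p: "p \<in> carrier P" "R = A #>\<^bsub>P\<^esub> p" using R cP by auto
      have "f x p = 1" if x: "x \<in> carrier Q" for x
        using F[OF x p(1)] bspec[OF R(2), of "C #>\<^bsub>Q\<^esub> x"] x by (simp add: cQ p(2))
      then have "p \<in> A" using p(1) unfolding A by simp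
      then show ?thesis using p(2) P.coset_join2[OF p(1) subA] by (simp add: FactGroup_def)
    qed
    show "F X R \<noteq> 0" if "X \<in> carrier (Q Mod C)" "R \<in> carrier (P Mod A)" for X R
      using that unfolding cP cQ by (elim imageE) (simp add: F nz)
    show "F (X \<otimes>\<^bsub>Q Mod C\<^esub> Y) R = F X R * F Y R"
      if "X \<in> carrier (Q Mod C)" "Y \<in> carrier (Q Mod C)" "R \<in> carrier (P Mod A)" for X Y R
      using that unfolding cP cQ by (elim imageE) (simp add: F C.rcos_sum multl)
    show "F X (R \<otimes>\<^bsub>P Mod A\<^esub> S) = F X R * F X S"
      if "X \<in> carrier (Q Mod C)" "R \<in> carrier (P Mod A)" "S \<in> carrier (P Mod A)" for X R S
      using that unfolding cP cQ by (elim imageE) (simp add: F A.rcos_sum multr)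
  qed
  then show ?thesis by (simp add: order_def FactGroup_def)
qed

section \<open>Open and compact subgroups\<close>

context topological_group
begin

lemma continuous_map_translate:
  assumes "a \<in> carrier G"
  shows "continuous_map T T (\<lambda>x. x \<otimes> a)"
proof -
  have "continuous_map T (prod_topology T T) (\<lambda>x. (x, a))"
    using assms topspace_eq_carrier by (intro continuous_map_pairedI) auto
  from continuous_map_compose[OF this continuous_map_mult] show ?thesis by (simp add: o_def)
qed

lemma openin_rcoset:
  assumes H: "openin T H" and a: "a \<in> carrier G"
  shows "openin T (H #> a)"
proof -
  have HG: "H \<subseteq> carrier G" using H topspace_eq_carrier openin_subset by metis
  have "H #> a = {x \<in> topspace T. x \<otimes> inv a \<in> H}" (is "?l = ?r")
  proof
    show "?l \<subseteq> ?r"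
    proof
      fix x assume "x \<in> H #> a"
      then obtain h where "h \<in> H" "x = h \<otimes> a" by (auto simp: r_coset_def)
      then show "x \<in> ?r" using HG a topspace_eq_carrier by (auto simp: m_assoc)
    qed
    show "?r \<subseteq> ?l"
    proof
      fix x assume x: "x \<in> ?r"
      then have "x = (x \<otimes> inv a) \<otimes> a" using a topspace_eq_carrier by (simp add: m_assoc)
      then show "x \<in> ?l" using x unfolding r_coset_def by blast
    qed
  qed
  then show ?thesis
    using openin_continuous_map_preimage[OF continuous_map_translate H, of "inv a"] a by simp
qed

lemma openin_set_mult:
  assumes "openin T H" "K \<subseteq> carrier G"
  shows "openin T (H <#> K)"
proof -
  have "openin T (\<Union>k\<in>K. H #> k)" using assms by (intro openin_Union) (auto intro: openin_rcoset)
  moreover have "H <#> K = (\<Union>k\<in>K. H #> k)" by (auto simp: set_mult_def r_coset_def)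
  ultimately show ?thesis by simp
qed

lemma compactin_set_mult:
  assumes "compactin T H" "compactin T K"
  shows "compactin T (H <#> K)"
proof -
  have "H <#> K = (\<lambda>(x, y). x \<otimes> y) ` (H \<times> K)" by (auto simp: set_mult_def)
  then show ?thesis
    using image_compactin[OF _ continuous_map_mult] assms by (simp add: compactin_Times)
qed

lemma subset_set_mult_right:
  assumes "subgroup H G" "K \<subseteq> carrier G"
  shows "K \<subseteq> H <#> K"
proof
  fix k assume "k \<in> K"
  then have "\<one> \<in> H" "k = \<one> \<otimes> k" using assms subgroup.one_closed by auto
  then show "k \<in> H <#> K" using \<open>k \<in> K\<close> unfolding set_mult_def by blast
qed

lemma subset_set_mult_left:
  assumes "subgroup K G" "H \<subseteq> carrier G"
  shows "H \<subseteq> H <#> K"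
proof
  fix h assume "h \<in> H"
  then have "\<one> \<in> K" "h = h \<otimes> \<one>" using assms subgroup.one_closed by auto
  then show "h \<in> H <#> K" using \<open>h \<in> H\<close> unfolding set_mult_def by blast
qed

lemma set_mult_subgroup_subset:
  assumes "subgroup H G" "A \<subseteq> H" "B \<subseteq> H"
  shows "A <#> B \<subseteq> H"
  using assms subgroup.m_closed unfolding set_mult_def by fastforce

text \<open>
  A subgroup is the union of the translates of any subset of it that contains the identity.
\<close>

lemma open_subgroupI:
  assumes H: "subgroup H G" and Q: "openin T Q" "\<one> \<in> Q" "Q \<subseteq> H"
  shows "openin T H"
proof -
  have OG: "Q \<subseteq> carrier G" using Q(3) subgroup.subset[OF H] by blast
  have "H \<subseteq> Q <#> H"
  proof
    fix h assume h: "h \<in> H"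
    then have "h = \<one> \<otimes> h" using subgroup.mem_carrier[OF H] by simp
    then show "h \<in> Q <#> H" using Q(2) h unfolding set_mult_def by blast
  qed
  moreover have "Q <#> H \<subseteq> H" by (rule set_mult_subgroup_subset[OF H Q(3)]) simp
  ultimately have "H = Q <#> H" by blast
  then show ?thesis using openin_set_mult[OF Q(1) subgroup.subset[OF H]] by simp
qed

lemma open_subgroup_closedin:
  assumes H: "subgroup H G" and op: "openin T H"
  shows "closedin T H"
proof -
  have "topspace T - H = (\<Union>a\<in>carrier G - H. H #> a)" (is "?l = ?r")
  proof
    show "?l \<subseteq> ?r" using topspace_eq_carrier rcos_self[OF _ H] by auto
    show "?r \<subseteq> ?l"
    proof
      fix x assume "x \<in> ?r"
      then obtain a h where a: "a \<in> carrier G" "a \<notin> H" and h: "h \<in> H" and x: "x = h \<otimes> a"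
        by (auto simp: r_coset_def)
      have hG: "h \<in> carrier G" using h subgroup.mem_carrier[OF H] by blast
      have "x \<notin> H"
      proof
        assume "x \<in> H"
        then have "inv h \<otimes> x \<in> H" using h H by (simp add: subgroup.m_closed subgroup.m_inv_closed)
        then show False using a hG x by (simp flip: m_assoc)
      qed
      then show "x \<in> ?l" using a hG x topspace_eq_carrier by simp
    qed
  qed
  then have "openin T (topspace T - H)" using openin_rcoset[OF op] by auto
  then show ?thesis using openin_subset[OF op] by (simp add: closedin_def)
qed

text \<open>
  Compactness relative to an open subgroup is finiteness modulo it. This yields finite indices and,
  later, reduces conditions on a compact set to conditions at finitely many points.
\<close>

lemma compact_finite_coset_cover:
  assumes H: "subgroup H G" "openin T H" and C: "compactin T C"
  obtains F where "finite F" "F \<subseteq> C" "C \<subseteq> (\<Union>c\<in>F. H #> c)"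
proof -
  have CG: "C \<subseteq> carrier G" using compactin_subset_topspace[OF C] topspace_eq_carrier by simp
  have "C \<subseteq> \<Union>((\<lambda>c. H #> c) ` C)" using rcos_self[OF _ H(1)] CG by blast
  moreover have "openin T U" if "U \<in> (\<lambda>c. H #> c) ` C" for U
    using that openin_rcoset[OF H(2)] CG by auto
  ultimately obtain \<F> where "finite \<F>" "\<F> \<subseteq> (\<lambda>c. H #> c) ` C" "C \<subseteq> \<Union>\<F>"
    using compactinD[OF C, of "(\<lambda>c. H #> c) ` C"] by meson
  with that show ?thesis by (metis finite_subset_image)
qed

lemma finite_rcosets_compact:
  assumes K: "subgroup K G" "compactin T K" and H: "subgroup H G" "openin T H"
  shows "finite (rcosets\<^bsub>G\<lparr>carrier := K\<rparr>\<^esub> H)"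
proof -
  have eq: "rcosets\<^bsub>G\<lparr>carrier := K\<rparr>\<^esub> H = (\<lambda>k. H #> k) ` K" by (auto simp: RCOSETS_def r_coset_def)
  have KG: "K \<subseteq> carrier G" using subgroup.subset[OF K(1)] .
  obtain F where F: "finite F" "F \<subseteq> K" "K \<subseteq> (\<Union>c\<in>F. H #> c)"
    using compact_finite_coset_cover[OF H K(2)] .
  have "(\<lambda>k. H #> k) ` K \<subseteq> (\<lambda>k. H #> k) ` F"
  proof
    fix C assume "C \<in> (\<lambda>k. H #> k) ` K"
    then obtain k where k: "k \<in> K" "C = H #> k" by blast
    then obtain c where c: "c \<in> F" "k \<in> H #> c" using F(3) by blast
    then have "H #> c = H #> k" using F(2) KG by (intro repr_independence[OF _ _ H(1)]) auto
    then show "C \<in> (\<lambda>k. H #> k) ` F" using c(1) k(2) by blast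
  qed
  then show ?thesis unfolding eq using F(1) finite_subset finite_imageI by metis
qed

lemma compact_open_subgroup_Int:
  assumes "Hausdorff_space T" "U \<in> compact_open_subgroups G T" "V \<in> compact_open_subgroups G T"
  shows "U \<inter> V \<in> compact_open_subgroups G T"
  using assms subgroups_Inter_pair compactin_Int by (auto simp: compact_open_subgroups_def Hausdorff_imp_kc_space)

text \<open>
  In a locally compact Hausdorff space a one-point component has arbitrarily small compact open
  neighbourhoods. For such a neighbourhood \<open>K\<close> of the identity, the elements whose right translation,
  together with that by their inverse, preserves \<open>K\<close> form a subgroup. It is contained in \<open>K\<close>
  because \<open>K\<close> contains the identity, and it is open by the tube lemma applied to the compact set \<open>K\<close>.
\<close>

theorem van_Dantzig:
  assumes lc: "locally_compact_space T" and Hd: "Hausdorff_space T"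
    and td: "totally_disconnected_space T" and Q: "openin T Q" "\<one> \<in> Q"
  obtains V where "V \<in> compact_open_subgroups G T" "V \<subseteq> Q"
proof -
  have one: "\<one> \<in> topspace T" using topspace_eq_carrier by simp
  have "neighbourhood_base_of (compactin T) T"
    using lc Hd locally_compact_space_neighbourhood_base by blast
  then obtain U C where UC: "openin T U" "compactin T C" "\<one> \<in> U" "U \<subseteq> C" "C \<subseteq> Q"
    unfolding neighbourhood_base_of using Q by meson
  have "{\<one>} \<in> connected_components_of T"
    using td one connected_component_in_connected_components_of
    unfolding totally_disconnected_space_def by metis
  then obtain K L where KL: "openin T K" "openin T L" "disjnt K L" "K \<union> L = topspace T"
      "{\<one>} \<subseteq> K" "K \<subseteq> U"
    using wilder_locally_compact_component_thm[OF lc Hd _ _ UC(1)] one UC(3)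
    by (metis compactin_sing empty_subsetI insert_subset)
  have "topspace T - K = L" using KL(3,4) by (auto simp: disjnt_iff)
  then have "closedin T K" using KL(1,2) openin_subset by (auto simp: closedin_def)
  then have K: "compactin T K" using UC(2) KL(6) UC(4) by (meson closed_compactin order_trans)
  have KG: "K \<subseteq> carrier G" using KL(1) openin_subset topspace_eq_carrier by metis
  define H where "H = {g \<in> carrier G. \<forall>k\<in>K. k \<otimes> g \<in> K \<and> k \<otimes> inv g \<in> K}"
  have H: "subgroup H G"
  proof (rule subgroupI)
    show "H \<subseteq> carrier G" "H \<noteq> {}" using KG by (auto simp: H_def intro!: exI[of _ \<one>])
    show "inv a \<in> H" if "a \<in> H" for a using that by (simp add: H_def)
    show "a \<otimes> b \<in> H" if ab: "a \<in> H" "b \<in> H" for a b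
    proof -
      have G: "a \<in> carrier G" "b \<in> carrier G" using ab by (auto simp: H_def)
      have "k \<otimes> (a \<otimes> b) \<in> K \<and> k \<otimes> inv (a \<otimes> b) \<in> K" if k: "k \<in> K" for k
      proof -
        have kG: "k \<in> carrier G" using k KG by blast
        have "k \<otimes> a \<otimes> b \<in> K" "k \<otimes> inv b \<otimes> inv a \<in> K" using ab k by (auto simp: H_def)
        then show ?thesis using kG G by (simp add: m_assoc inv_mult_group)
      qed
      then show ?thesis using G by (simp add: H_def)
    qed
  qed
  have HK: "H \<subseteq> K"
  proof
    fix g assume g: "g \<in> H"
    then have "\<one> \<otimes> g \<in> K" "g \<in> carrier G" using KL(5) by (auto simp: H_def)
    then show "g \<in> K" by simp
  qed
  let ?W = "{p \<in> topspace (prod_topology T T). (\<lambda>(x, y). x \<otimes> y) p \<in> K}"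
  have opW: "openin (prod_topology T T) ?W"
    using openin_continuous_map_preimage[OF continuous_map_mult KL(1)] .
  have subW: "K \<times> {\<one>} \<subseteq> ?W" using KG topspace_eq_carrier by auto
  obtain P V where PV: "openin T V" "K \<subseteq> P" "\<one> \<in> V" "P \<times> V \<subseteq> ?W"
    using tube_lemma_left[OF opW K one subW] by (elim exE conjE) (rule that)
  let ?N = "{x \<in> V. inv x \<in> V}"
  have "openin T ?N"
    using openin_continuous_map_preimage_gen[OF continuous_map_inv PV(1) PV(1)] .
  moreover have "?N \<subseteq> H"
  proof
    fix x assume x: "x \<in> ?N"
    then have "x \<in> carrier G" using PV(1) openin_subset topspace_eq_carrier by blast
    moreover have "k \<otimes> x \<in> K \<and> k \<otimes> inv x \<in> K" if "k \<in> K" for k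
      using subsetD[OF PV(4), of "(k, x)"] subsetD[OF PV(4), of "(k, inv x)"] that PV(2) x by auto
    ultimately show "x \<in> H" by (simp add: H_def)
  qed
  ultimately have op: "openin T H" using open_subgroupI[OF H, of ?N] PV(3) by simp
  have "compactin T H" using closed_compactin[OF K HK open_subgroup_closedin[OF H op]] .
  with H op HK that show ?thesis using KL(6) UC(4,5) by (auto simp: compact_open_subgroups_def)
qed

end

text \<open>
  Starting from any compact open subgroup \<open>V\<close>, multiply by a compact subgroup through each of finitely
  many representatives of the cosets of \<open>V\<close> that meet \<open>C\<close>. Commutativity makes each product a
  subgroup; it is compact as an image of a product and open as a union of translates.
\<close>

lemma (in locally_compact_abelian_group) compact_subset_compact_open_subgroup:
  assumes td: "totally_disconnected_space T" and cc: "compactly_covered G T" and C: "compactin T C"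
  obtains W where "W \<in> compact_open_subgroups G T" "C \<subseteq> W"
proof -
  obtain V where V: "V \<in> compact_open_subgroups G T"
    using van_Dantzig[OF locally_compact Hausdorff td openin_topspace] topspace_eq_carrier one_closed
    by blast
  have fin: "\<exists>W\<in>compact_open_subgroups G T. V \<subseteq> W \<and> F \<subseteq> W" if "finite F" "F \<subseteq> carrier G" for F
    using that
  proof induction
    case empty then show ?case using V by blast
  next
    case (insert x F)
    then obtain W where W: "W \<in> compact_open_subgroups G T" "V \<subseteq> W" "F \<subseteq> W" by blast
    obtain K where K: "subgroup K G" "compactin T K" "x \<in> K"
      using cc insert.prems unfolding compactly_covered_def by blast
    have sW: "subgroup W G" "compactin T W" "openin T W" using W by (auto simp: compact_open_subgroups_def)
    have "W <#> K \<in> compact_open_subgroups G T"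
      using mult_subgroups[OF sW(1) K(1)] compactin_set_mult[OF sW(2) K(2)]
        openin_set_mult[OF sW(3) subgroup.subset[OF K(1)]] by (simp add: compact_open_subgroups_def)
    moreover have "W \<subseteq> W <#> K" "K \<subseteq> W <#> K"
      using subset_set_mult_left[OF K(1)] subset_set_mult_right[OF sW(1)] subgroup.subset sW(1) K(1)
      by metis+
    ultimately show ?case using W K(3) by (intro bexI[of _ "W <#> K"]) auto
  qed
  have sV: "subgroup V G" "openin T V" using V by (auto simp: compact_open_subgroups_def)
  have CG: "C \<subseteq> carrier G" using compactin_subset_topspace[OF C] topspace_eq_carrier by simp
  obtain F where F: "finite F" "F \<subseteq> C" "C \<subseteq> (\<Union>c\<in>F. V #> c)"
    using compact_finite_coset_cover[OF sV C] .
  then obtain W where W: "W \<in> compact_open_subgroups G T" "V \<subseteq> W" "F \<subseteq> W"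
    using fin CG by (meson order_trans)
  have sW: "subgroup W G" using W by (simp add: compact_open_subgroups_def)
  have "V #> c \<subseteq> W" if "c \<in> F" for c
    using that W subgroup.m_closed[OF sW] by (auto simp: r_coset_def)
  then have "C \<subseteq> W" using F(3) by blast
  with W that show ?thesis by blast
qed

section \<open>The dual group and its topology\<close>

lemma topspace_circle_topology [simp]: "topspace circle_topology = sphere 0 1"
  by (simp add: circle_topology_def)

lemma continuous_map_circle_iff:
  "continuous_map X circle_topology f \<longleftrightarrow>
     continuous_map X euclidean f \<and> (\<forall>x\<in>topspace X. cmod (f x) = 1)"
  by (auto simp: circle_topology_def continuous_map_in_subtopology)

lemma continuous_map_complex_mult:
  fixes f g :: "'a \<Rightarrow> complex"
  assumes "continuous_map X euclidean f" "continuous_map X euclidean g"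
  shows "continuous_map X euclidean (\<lambda>x. f x * g x)"
proof -
  have "continuous_map (prod_topology euclidean euclidean) euclidean (\<lambda>p. fst p * snd p :: complex)"
    by (simp add: continuous_intros)
  from continuous_map_compose[OF continuous_map_pairedI[OF assms] this]
  show ?thesis by (simp add: o_def)
qed

lemma continuous_map_complex_cnj:
  fixes f :: "'a \<Rightarrow> complex"
  assumes "continuous_map X euclidean f"
  shows "continuous_map X euclidean (\<lambda>x. cnj (f x))"
proof -
  have "continuous_map euclidean euclidean cnj" by (simp add: continuous_intros)
  from continuous_map_compose[OF assms this] show ?thesis by (simp add: o_def)
qed

lemma cnj_mult_self_circle: "cmod z = 1 \<Longrightarrow> cnj z * z = 1"
  by (metis complex_norm_square mult.commute of_real_1 power_one)

context topological_group
begin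

abbreviation "dualG \<equiv> dual_group G T"

abbreviation "annih U \<equiv> annihilator_in_dual G T U"

lemma dual_carrierD:
  assumes "\<xi> \<in> carrier dualG"
  shows "\<xi> \<in> extensional (carrier G)" "\<xi> \<in> hom G circle_group" "continuous_map T circle_topology \<xi>"
    "x \<in> carrier G \<Longrightarrow> cmod (\<xi> x) = 1" "\<xi> \<one> = 1"
    "x \<in> carrier G \<Longrightarrow> y \<in> carrier G \<Longrightarrow> \<xi> (x \<otimes> y) = \<xi> x * \<xi> y"
    "x \<in> carrier G \<Longrightarrow> \<xi> (inv x) = cnj (\<xi> x)"
proof -
  show ext: "\<xi> \<in> extensional (carrier G)" and h: "\<xi> \<in> hom G circle_group"
    and "continuous_map T circle_topology \<xi>" using assms by (auto simp: dual_group_def)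
  show n: "x \<in> carrier G \<Longrightarrow> cmod (\<xi> x) = 1" for x using hom_in_carrier[OF h, of x] by simp
  show m: "x \<in> carrier G \<Longrightarrow> y \<in> carrier G \<Longrightarrow> \<xi> (x \<otimes> y) = \<xi> x * \<xi> y" for x y
    using hom_mult[OF h, of x y] by simp
  show o: "\<xi> \<one> = 1" using m[of \<one> \<one>] n[of \<one>] by auto
  show "\<xi> (inv x) = cnj (\<xi> x)" if x: "x \<in> carrier G"
  proof -
    have e: "\<xi> (inv x) * \<xi> x = 1" using m[of "inv x" x] x o by simp
    have c: "cnj (\<xi> x) * \<xi> x = 1" using cnj_mult_self_circle[OF n[OF x]] .
    have "\<xi> x \<noteq> 0" using n[OF x] by auto
    moreover have "\<xi> (inv x) * \<xi> x = cnj (\<xi> x) * \<xi> x" using e c by simp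
    ultimately show ?thesis by (metis mult_right_cancel)
  qed
qed

lemma dual_carrierI:
  assumes "\<And>x y. x \<in> carrier G \<Longrightarrow> y \<in> carrier G \<Longrightarrow> f (x \<otimes> y) = f x * f y"
    and "continuous_map T circle_topology f"
  shows "(\<lambda>x\<in>carrier G. f x) \<in> carrier dualG"
proof -
  have "cmod (f x) = 1" if "x \<in> carrier G" for x
    using assms(2) that by (simp add: continuous_map_circle_iff topspace_eq_carrier)
  then have "(\<lambda>x\<in>carrier G. f x) \<in> hom G circle_group" by (auto simp: hom_def assms(1))
  moreover have "continuous_map T circle_topology (\<lambda>x\<in>carrier G. f x)"
    using assms(2) by (rule continuous_map_eq) (simp add: topspace_eq_carrier)
  ultimately show ?thesis by (simp add: dual_group_def)
qed

lemma dual_mult: "x \<in> carrier G \<Longrightarrow> (\<xi> \<otimes>\<^bsub>dualG\<^esub> \<eta>) x = \<xi> x * \<eta> x"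
  by (simp add: dual_group_def)

lemma dual_one: "x \<in> carrier G \<Longrightarrow> \<one>\<^bsub>dualG\<^esub> x = 1"
  by (simp add: dual_group_def)

lemma dual_eqI:
  assumes "\<xi> \<in> carrier dualG" "\<eta> \<in> carrier dualG" "\<And>x. x \<in> carrier G \<Longrightarrow> \<xi> x = \<eta> x"
  shows "\<xi> = \<eta>"
  using extensionalityI[OF dual_carrierD(1) dual_carrierD(1)] assms by blast

lemma dual_inverse:
  assumes \<xi>: "\<xi> \<in> carrier dualG"
  shows "(\<lambda>x\<in>carrier G. cnj (\<xi> x)) \<in> carrier dualG"
proof (rule dual_carrierI)
  show "continuous_map T circle_topology (\<lambda>x. cnj (\<xi> x))"
    using dual_carrierD(3)[OF \<xi>] continuous_map_complex_cnj by (auto simp: continuous_map_circle_iff)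
qed (simp add: dual_carrierD(6)[OF \<xi>])

lemma dual_mult_closed:
  assumes \<xi>: "\<xi> \<in> carrier dualG" and \<eta>: "\<eta> \<in> carrier dualG"
  shows "\<xi> \<otimes>\<^bsub>dualG\<^esub> \<eta> \<in> carrier dualG"
proof -
  have "(\<lambda>x\<in>carrier G. \<xi> x * \<eta> x) \<in> carrier dualG"
  proof (rule dual_carrierI)
    show "continuous_map T circle_topology (\<lambda>x. \<xi> x * \<eta> x)"
      using dual_carrierD(3)[OF \<xi>] dual_carrierD(3)[OF \<eta>] continuous_map_complex_mult
      by (auto simp: continuous_map_circle_iff norm_mult)
  qed (simp add: dual_carrierD(6)[OF \<xi>] dual_carrierD(6)[OF \<eta>])
  then show ?thesis by (simp add: dual_group_def)
qed

lemma dual_one_closed: "\<one>\<^bsub>dualG\<^esub> \<in> carrier dualG"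
proof -
  have "(\<lambda>x\<in>carrier G. 1) \<in> carrier dualG"
    by (rule dual_carrierI) (auto simp: continuous_map_circle_iff)
  then show ?thesis by (simp add: dual_group_def)
qed

lemma dual_comm_group: "comm_group dualG"
proof (rule comm_groupI)
  fix \<xi> \<eta> \<zeta> assume c: "\<xi> \<in> carrier dualG" "\<eta> \<in> carrier dualG" "\<zeta> \<in> carrier dualG"
  show "\<xi> \<otimes>\<^bsub>dualG\<^esub> \<eta> \<otimes>\<^bsub>dualG\<^esub> \<zeta> = \<xi> \<otimes>\<^bsub>dualG\<^esub> (\<eta> \<otimes>\<^bsub>dualG\<^esub> \<zeta>)"
    using c by (intro dual_eqI dual_mult_closed) (simp_all add: dual_mult)
next
  fix \<xi> \<eta> assume c: "\<xi> \<in> carrier dualG" "\<eta> \<in> carrier dualG"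
  show "\<xi> \<otimes>\<^bsub>dualG\<^esub> \<eta> \<in> carrier dualG" using c by (rule dual_mult_closed)
  show "\<xi> \<otimes>\<^bsub>dualG\<^esub> \<eta> = \<eta> \<otimes>\<^bsub>dualG\<^esub> \<xi>"
    using c by (intro dual_eqI dual_mult_closed) (simp_all add: dual_mult)
next
  fix \<xi> assume c: "\<xi> \<in> carrier dualG"
  show "\<one>\<^bsub>dualG\<^esub> \<otimes>\<^bsub>dualG\<^esub> \<xi> = \<xi>"
    using c by (intro dual_eqI dual_mult_closed dual_one_closed) (simp_all add: dual_mult dual_one)
  have "(\<lambda>x\<in>carrier G. cnj (\<xi> x)) \<otimes>\<^bsub>dualG\<^esub> \<xi> = \<one>\<^bsub>dualG\<^esub>"
    using c dual_inverse[OF c]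
    by (intro dual_eqI dual_mult_closed dual_one_closed)
      (simp_all add: dual_mult dual_one cnj_mult_self_circle dual_carrierD(4))
  then show "\<exists>\<eta>\<in>carrier dualG. \<eta> \<otimes>\<^bsub>dualG\<^esub> \<xi> = \<one>\<^bsub>dualG\<^esub>" using dual_inverse[OF c] by (rule bexI)
qed (rule dual_one_closed)

lemma dual_inv:
  assumes \<xi>: "\<xi> \<in> carrier dualG"
  shows "inv\<^bsub>dualG\<^esub> \<xi> = (\<lambda>x\<in>carrier G. cnj (\<xi> x))"
proof -
  interpret D: comm_group dualG by (rule dual_comm_group)
  show ?thesis
  proof (rule D.inv_equality)
    show "(\<lambda>x\<in>carrier G. cnj (\<xi> x)) \<otimes>\<^bsub>dualG\<^esub> \<xi> = \<one>\<^bsub>dualG\<^esub>"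
      using \<xi> dual_inverse[OF \<xi>]
      by (intro dual_eqI dual_mult_closed dual_one_closed)
        (simp_all add: dual_mult dual_one cnj_mult_self_circle dual_carrierD(4))
  qed (use \<xi> dual_inverse in auto)
qed

lemma annihilator_iff: "\<xi> \<in> annih U \<longleftrightarrow> \<xi> \<in> carrier dualG \<and> (\<forall>x\<in>U. \<xi> x = 1)"
  by (simp add: annihilator_in_dual_def)

lemma annihilator_subgroup:
  assumes "U \<subseteq> carrier G"
  shows "subgroup (annih U) dualG"
proof -
  interpret D: comm_group dualG by (rule dual_comm_group)
  show ?thesis
  proof (rule D.subgroupI)
    show "annih U \<subseteq> carrier dualG" by (auto simp: annihilator_iff)
    have "\<one>\<^bsub>dualG\<^esub> \<in> annih U" using assms by (auto simp: annihilator_iff dual_one)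
    then show "annih U \<noteq> {}" by blast
    show "inv\<^bsub>dualG\<^esub> \<xi> \<in> annih U" if "\<xi> \<in> annih U" for \<xi>
      using that assms dual_inverse[of \<xi>] by (auto simp: annihilator_iff dual_inv)
    show "\<xi> \<otimes>\<^bsub>dualG\<^esub> \<eta> \<in> annih U" if "\<xi> \<in> annih U" "\<eta> \<in> annih U" for \<xi> \<eta>
      using that assms by (auto simp: annihilator_iff dual_mult subset_iff)
  qed
qed

text \<open>
  The preimage of any set is a union of cosets of \<open>M\<close>, so every such homomorphism is even locally
  constant.
\<close>

lemma character_continuousI:
  assumes M: "subgroup M G" "openin T M" and \<xi>: "\<xi> \<in> hom G circle_group" "\<And>m. m \<in> M \<Longrightarrow> \<xi> m = 1"
  shows "continuous_map T circle_topology \<xi>"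
  unfolding continuous_map_def
proof (intro conjI allI impI)
  show "\<xi> \<in> topspace T \<rightarrow> topspace circle_topology"
    using hom_in_carrier[OF \<xi>(1)] by (auto simp: topspace_eq_carrier circle_topology_def)
  fix V
  let ?S = "{x \<in> topspace T. \<xi> x \<in> V}"
  have SG: "?S \<subseteq> carrier G" by (auto simp: topspace_eq_carrier)
  have "M <#> ?S \<subseteq> ?S"
  proof
    fix x assume "x \<in> M <#> ?S"
    then obtain m s where "m \<in> M" "s \<in> ?S" "x = m \<otimes> s" by (auto simp: set_mult_def)
    then show "x \<in> ?S" using hom_mult[OF \<xi>(1), of m s] \<xi>(2) subgroup.mem_carrier[OF M(1)]
      by (auto simp: topspace_eq_carrier)
  qed
  then have "?S = M <#> ?S" using subset_set_mult_right[OF M(1) SG] by blast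
  then show "openin T ?S" using openin_set_mult[OF M(2) SG] by simp
qed

lemma character_pow:
  assumes "\<xi> \<in> carrier dualG" "x \<in> carrier G"
  shows "\<xi> (x [^] (n::nat)) = \<xi> x ^ n"
  using assms by (induction n) (simp_all add: dual_carrierD)

text \<open>
  The image of \<open>U\<close> is a subgroup of the circle inside a small neighbourhood of 1.
\<close>

lemma annihilator_near_1:
  assumes \<xi>: "\<xi> \<in> carrier dualG" and U: "subgroup U G" and near: "\<And>u. u \<in> U \<Longrightarrow> cmod (\<xi> u - 1) < 1/2"
  shows "\<xi> \<in> annih U"
proof -
  have "\<xi> u = 1" if u: "u \<in> U" for u
  proof (rule circle_no_small_subgroups)
    have uG: "u \<in> carrier G" using subgroup.mem_carrier[OF U u] .
    show "cmod (\<xi> u) = 1" using dual_carrierD(4)[OF \<xi> uG] .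
    have "u [^] n \<in> U" for n :: nat
      using u subgroup.m_closed[OF U] subgroup.one_closed[OF U] by (induction n) auto
    from near[OF this] show "cmod (\<xi> u ^ n - 1) < 1/2" for n using character_pow[OF \<xi> uG] by simp
  qed
  then show ?thesis using \<xi> by (simp add: annihilator_iff)
qed

lemma topspace_dual_topology: "topspace (dual_topology G T) = carrier dualG"
proof -
  have "\<xi> \<in> topspace (compact_open_topology T circle_topology)" if "\<xi> \<in> carrier dualG" for \<xi>
    unfolding compact_open_topology_def topology_generated_by_topspace
    using dual_carrierD(1,3)[OF that] topspace_eq_carrier
    by (intro UnionI[of "{f \<in> extensional (topspace T). continuous_map T circle_topology f \<and> f ` {} \<subseteq> {}}"])
      (auto intro!: exI[of _ "{}"])
  then show ?thesis by (auto simp: dual_topology_def)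
qed

text \<open>
  By the absence of small subgroups in the circle, mapping \<open>U\<close> into a small neighbourhood of 1 already
  forces triviality on \<open>U\<close>, and for compact \<open>U\<close> this is a subbasic condition.
\<close>

lemma annihilator_openin:
  assumes U: "subgroup U G" "compactin T U"
  shows "openin (dual_topology G T) (annih U)"
proof -
  let ?V = "{z \<in> sphere 0 1. cmod (z - 1) < 1/2}"
  let ?S = "{f \<in> extensional (topspace T). continuous_map T circle_topology f \<and> f ` U \<subseteq> ?V}"
  have "?V = sphere 0 1 \<inter> ball 1 (1/2)" by (auto simp: dist_norm norm_minus_commute)
  then have "openin circle_topology ?V" by (auto simp: circle_topology_def)
  then have opS: "openin (compact_open_topology T circle_topology) ?S"
    unfolding compact_open_topology_def using U(2) by (intro topology_generated_by_Basis) blast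
  have eq: "annih U = ?S \<inter> carrier dualG"
  proof
    show "annih U \<subseteq> ?S \<inter> carrier dualG"
      using dual_carrierD(1,3) by (auto simp: annihilator_iff topspace_eq_carrier)
    show "?S \<inter> carrier dualG \<subseteq> annih U" using annihilator_near_1[OF _ U(1)] by blast
  qed
  show ?thesis unfolding dual_topology_def openin_subtopology by (intro exI[of _ ?S] conjI opS eq)
qed

text \<open>
  On the characters that are trivial on the open subgroup \<open>U\<close>, continuity is automatic, so they form
  a closed subset of the power of the circle indexed by \<open>G\<close>, which is compact by Tychonoff's
  theorem. The compact-open topology is no finer there than the topology of pointwise convergence,
  because a compact set meets only finitely many cosets of \<open>U\<close> and each of these characters is
  constant on every coset.
\<close>

lemma annihilator_compactin:
  assumes U: "subgroup U G" "openin T U"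
  shows "compactin (dual_topology G T) (annih U)"
proof -
  let ?P = "product_topology (\<lambda>_. circle_topology) (carrier G)"
  let ?Z = "annih U"
  have topP: "topspace ?P = carrier G \<rightarrow>\<^sub>E sphere 0 1" by simp
  have coord: "continuous_map ?P euclidean (\<lambda>f. f x)" if "x \<in> carrier G" for x
    using continuous_map_product_projection[OF that, of "\<lambda>_. circle_topology"]
    by (simp add: continuous_map_circle_iff)
  let ?M = "\<lambda>(x, y). {f \<in> topspace ?P. f (x \<otimes> y) = f x * f y}"
  let ?E = "\<lambda>u. {f \<in> topspace ?P. f u = 1}"
  have UG: "U \<subseteq> carrier G" using subgroup.subset[OF U(1)] .
  have "?Z = (\<Inter>p\<in>carrier G \<times> carrier G. ?M p) \<inter> (\<Inter>u\<in>U. ?E u)" (is "_ = ?R")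
  proof
    show "?Z \<subseteq> ?R"
    proof
      fix \<xi> assume \<xi>: "\<xi> \<in> ?Z"
      then have c: "\<xi> \<in> carrier dualG" by (simp add: annihilator_iff)
      then have "\<xi> \<in> topspace ?P"
        using dual_carrierD(1)[OF c] dual_carrierD(4)[OF c] by (auto simp: PiE_def)
      then show "\<xi> \<in> ?R"
        using \<xi> dual_carrierD(6)[OF c] by (auto simp: annihilator_iff)
    qed
    show "?R \<subseteq> ?Z"
    proof
      fix f assume f: "f \<in> ?R"
      then have "\<one> \<in> carrier G" "f \<in> ?M (\<one>, \<one>)" by blast+
      then have fP: "f \<in> carrier G \<rightarrow>\<^sub>E sphere 0 1" by (simp add: topP)
      have h: "f \<in> hom G circle_group" using f fP by (auto simp: hom_def)
      have u: "f u = 1" if "u \<in> U" for u using f that by blast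
      have "continuous_map T circle_topology f" using character_continuousI[OF U h u] .
      then have "f \<in> carrier dualG" using h fP by (simp add: dual_group_def PiE_def)
      then show "f \<in> ?Z" using u by (simp add: annihilator_iff)
    qed
  qed
  moreover have "closedin ?P (\<Inter>p\<in>carrier G \<times> carrier G. ?M p)"
  proof (rule closedin_INT)
    show "closedin ?P (?M p)" if p0: "p \<in> carrier G \<times> carrier G" for p
    proof -
      obtain x y where p: "p = (x, y)" "x \<in> carrier G" "y \<in> carrier G" using p0 by blast
      have "closedin ?P {f \<in> topspace ?P. f (x \<otimes> y) = f x * f y}"
        by (intro closedin_continuous_maps_eq[of euclidean] coord continuous_map_complex_mult)
          (use p in auto)
      then show ?thesis by (simp only: p prod.case)
    qed
  qed auto
  moreover have "closedin ?P (\<Inter>u\<in>U. ?E u)"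
  proof (rule closedin_INT)
    show "closedin ?P (?E u)" if "u \<in> U" for u
      by (intro closedin_continuous_maps_eq[of euclidean] coord) (use that UG in auto)
  qed (use subgroup.one_closed[OF U(1)] in auto)
  ultimately have "closedin ?P ?Z" by auto
  moreover have "compact_space ?P"
    by (simp add: compact_space_product_topology circle_topology_def compact_space_subtopology)
  ultimately have "compactin ?P ?Z" by (rule closedin_compact_space[rotated])
  then have cZ: "compactin (subtopology ?P ?Z) ?Z" by (simp add: compactin_subtopology)
  have Z_top: "?Z \<subseteq> topspace ?P" using \<open>closedin ?P ?Z\<close> by (rule closedin_subset)
  have "continuous_map (subtopology ?P ?Z) (compact_open_topology T circle_topology) id"
    unfolding compact_open_topology_def
  proof (rule continuous_on_generated_topo)
    let ?\<S> = "{{f \<in> extensional (topspace T). continuous_map T circle_topology f \<and> f ` K \<subseteq> V} |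
       K V. compactin T K \<and> openin circle_topology V}"
    show "id ` topspace (subtopology ?P ?Z) \<subseteq> \<Union>?\<S>"
    proof -
      have "carrier dualG \<subseteq> topspace (compact_open_topology T circle_topology)"
        using topspace_dual_topology unfolding dual_topology_def topspace_subtopology by (metis inf_le1)
      then have "carrier dualG \<subseteq> \<Union>?\<S>"
        unfolding compact_open_topology_def topology_generated_by_topspace .
      then have "?Z \<subseteq> \<Union>?\<S>" by (rule order_trans[rotated]) (simp add: annihilator_in_dual_def)
      moreover have "id ` topspace (subtopology ?P ?Z) \<subseteq> ?Z" by simp
      ultimately show ?thesis by (rule order_trans[rotated])
    qed
    fix W assume "W \<in> ?\<S>"
    then obtain K V where W: "W = {f \<in> extensional (topspace T). continuous_map T circle_topology f \<and> f ` K \<subseteq> V}"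
      and K: "compactin T K" and V: "openin circle_topology V" by blast
    obtain F where F: "finite F" "F \<subseteq> K" "K \<subseteq> (\<Union>c\<in>F. U #> c)"
      using compact_finite_coset_cover[OF U K] .
    have KG: "K \<subseteq> carrier G" using compactin_subset_topspace[OF K] topspace_eq_carrier by simp
    have key: "f ` K \<subseteq> V \<longleftrightarrow> (\<forall>c\<in>F. f c \<in> V)" if f: "f \<in> ?Z" for f
    proof
      assume "\<forall>c\<in>F. f c \<in> V"
      show "f ` K \<subseteq> V"
      proof
        fix z assume "z \<in> f ` K"
        then obtain k where k: "k \<in> K" "z = f k" by blast
        then obtain c u where c: "c \<in> F" "u \<in> U" "k = u \<otimes> c" using F(3) by (auto simp: r_coset_def)
        then have "f k = f u * f c" using f UG F(2) KG dual_carrierD(6)[of f u c]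
          by (auto simp: annihilator_iff)
        also have "f u = 1" using c f by (simp add: annihilator_iff)
        finally show "z \<in> V" using k c \<open>\<forall>c\<in>F. f c \<in> V\<close> by simp
      qed
    qed (use F(2) in auto)
    have inW: "f \<in> W \<longleftrightarrow> (\<forall>c\<in>F. f c \<in> V)" if f: "f \<in> ?Z" for f
      using key[OF f] f dual_carrierD(1,3)[of f] by (simp add: W annihilator_iff topspace_eq_carrier)
    let ?R = "(\<Inter>c\<in>F. {f \<in> topspace ?P. f c \<in> V}) \<inter> topspace ?P"
    have top_sub: "topspace (subtopology ?P ?Z) = ?Z"
      using Z_top unfolding topspace_subtopology by (rule Int_absorb1)
    have eq: "id -` W \<inter> ?Z = ?Z \<inter> ?R"
    proof (rule Set.set_eqI)
      fix f
      have "f \<in> topspace ?P" if "f \<in> ?Z" using Z_top that by (rule subsetD)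
      then show "f \<in> id -` W \<inter> ?Z \<longleftrightarrow> f \<in> ?Z \<inter> ?R"
        using inW[of f] by (cases "f \<in> ?Z") simp_all
    qed
    have "openin ?P {f \<in> topspace ?P. f c \<in> V}" if "c \<in> F" for c
      using that F(2) KG by (intro openin_continuous_map_preimage[OF _ V] continuous_map_product_projection) auto
    then have opR: "openin ?P ?R" by (rule openin_INT[OF F(1)])
    show "openin (subtopology ?P ?Z) (id -` W \<inter> topspace (subtopology ?P ?Z))"
      unfolding top_sub eq using opR by (rule openin_subtopology_Int2)
  qed
  then have "continuous_map (subtopology ?P ?Z) (dual_topology G T) id"
    unfolding dual_topology_def by (auto simp: continuous_map_in_subtopology annihilator_iff)
  from image_compactin[OF cZ this] show ?thesis by simp
qed

text \<open>
  If the trivial character satisfies a subbasic condition on \<open>K\<close>, so does every character that is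
  trivial on \<open>K\<close>. Finite intersections correspond to finite unions of compact sets.
\<close>

lemma open_dual_contains_annihilator:
  assumes N: "openin (dual_topology G T) N" "\<one>\<^bsub>dualG\<^esub> \<in> N"
  shows "\<exists>K. compactin T K \<and> annih K \<subseteq> N"
proof -
  let ?\<S> = "{{f \<in> extensional (topspace T). continuous_map T circle_topology f \<and> f ` K \<subseteq> V} |
     K V. compactin T K \<and> openin circle_topology V}"
  obtain A where A: "openin (compact_open_topology T circle_topology) A" "N = A \<inter> carrier dualG"
    using N(1) by (auto simp: dual_topology_def openin_subtopology)
  have "generate_topology_on ?\<S> A"
    using A(1) unfolding compact_open_topology_def by (rule openin_topology_generated_by)
  then have "\<one>\<^bsub>dualG\<^esub> \<in> A \<Longrightarrow> \<exists>K. compactin T K \<and> annih K \<subseteq> A"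
  proof induction
    case Empty then show ?case by simp
  next
    case (Int a b)
    then obtain K L where "compactin T K" "annih K \<subseteq> a" "compactin T L" "annih L \<subseteq> b" by auto
    then show ?case by (intro exI[of _ "K \<union> L"]) (auto simp: compactin_Un annihilator_iff)
  next
    case (UN \<K>)
    then obtain k where "k \<in> \<K>" "\<one>\<^bsub>dualG\<^esub> \<in> k" by blast
    with UN(2)[OF this] show ?case by blast
  next
    case (Basis s)
    then obtain K V where s: "s = {f \<in> extensional (topspace T). continuous_map T circle_topology f \<and> f ` K \<subseteq> V}"
      and K: "compactin T K" by blast
    have KG: "K \<subseteq> carrier G" using compactin_subset_topspace[OF K] topspace_eq_carrier by simp
    have "1 \<in> V" if "k \<in> K" for k
    proof -
      have "\<one>\<^bsub>dualG\<^esub> k \<in> V" using Basis.prems that by (auto simp: s)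
      then show ?thesis using dual_one[of k] KG that by auto
    qed
    then have "annih K \<subseteq> s"
      using dual_carrierD(1,3) by (auto simp: s annihilator_iff topspace_eq_carrier)
    then show ?case using K by blast
  qed
  then obtain K where "compactin T K" "annih K \<subseteq> A" using N(2) A(2) by blast
  then show ?thesis using A(2) by (intro exI[of _ K]) (auto simp: annihilator_iff)
qed

end

lemma (in comm_group) subgroup_comm_group:
  assumes "subgroup H G"
  shows "comm_group (G\<lparr>carrier := H\<rparr>)"
proof (rule group.group_comm_groupI)
  show "group (G\<lparr>carrier := H\<rparr>)" using subgroup.subgroup_is_group[OF assms is_group] .
qed (simp add: m_comm subgroup.mem_carrier[OF assms])

definition coannihilator :: "('a, 'm) monoid_scheme \<Rightarrow> ('a \<Rightarrow> complex) set \<Rightarrow> 'a set" where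
  "coannihilator G N = {x \<in> carrier G. \<forall>\<xi>\<in>N. \<xi> x = 1}"

lemma (in topological_group) coannihilator_subgroup:
  assumes "N \<subseteq> carrier dualG"
  shows "subgroup (coannihilator G N) G"
proof (rule subgroupI)
  have d: "\<xi> \<in> carrier dualG" if "\<xi> \<in> N" for \<xi> using assms that by (rule subsetD)
  show "coannihilator G N \<subseteq> carrier G" by (auto simp: coannihilator_def)
  have "\<one> \<in> coannihilator G N" using dual_carrierD(5)[OF d] by (simp add: coannihilator_def)
  then show "coannihilator G N \<noteq> {}" by blast
  show "inv x \<in> coannihilator G N" if "x \<in> coannihilator G N" for x
    using that by (auto simp: coannihilator_def dual_carrierD(7)[OF d])
  show "x \<otimes> y \<in> coannihilator G N" if "x \<in> coannihilator G N" "y \<in> coannihilator G N" for x y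
    using that by (auto simp: coannihilator_def dual_carrierD(6)[OF d])
qed

lemma (in topological_group) annihilator_antimono:
  assumes "K \<subseteq> H"
  shows "annih H \<subseteq> annih K"
proof
  fix \<xi> assume \<xi>: "\<xi> \<in> annih H"
  have "\<xi> x = 1" if "x \<in> K" for x
    using \<xi> subsetD[OF assms that] by (simp add: annihilator_iff)
  then show "\<xi> \<in> annih K" using \<xi> unfolding annihilator_iff by blast
qed

section \<open>Annihilators in totally disconnected groups\<close>

locale tdlc_abelian_group = locally_compact_abelian_group +
  assumes totally_disconnected: "totally_disconnected_space T"
begin

lemma small_subgroup:
  assumes "openin T Q" "\<one> \<in> Q"
  obtains V where "V \<in> compact_open_subgroups G T" "V \<subseteq> Q"
  using van_Dantzig[OF locally_compact Hausdorff totally_disconnected assms] .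

lemma compact_open_subgroupD:
  assumes "U \<in> compact_open_subgroups G T"
  shows "subgroup U G" "compactin T U" "openin T U" "closedin T U" "U \<subseteq> carrier G"
  using assms open_subgroup_closedin subgroup.subset by (auto simp: compact_open_subgroups_def)

text \<open>
  Since \<open>H\<close> is closed, some compact open subgroup \<open>V\<close> has \<open>x \<notin> V H\<close>. Then \<open>V H\<close> is an open
  subgroup, and an algebraic character that is trivial on it but not at \<open>x\<close> is automatically
  continuous.
\<close>

lemma closed_subgroup_separated:
  assumes H: "subgroup H G" "closedin T H" and x: "x \<in> carrier G" "x \<notin> H"
  shows "\<exists>\<xi>\<in>annih H. \<xi> x \<noteq> 1"
proof -
  have "openin T (topspace T - H)" using H(2) by (rule openin_diff[OF openin_topspace])
  then have "openin T {v \<in> topspace T. v \<otimes> x \<in> topspace T - H}"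
    by (rule openin_continuous_map_preimage[OF continuous_map_translate[OF x(1)]])
  moreover have "\<one> \<in> {v \<in> topspace T. v \<otimes> x \<in> topspace T - H}"
    using x by (simp add: topspace_eq_carrier)
  ultimately obtain V where V: "V \<in> compact_open_subgroups G T"
    and VH: "V \<subseteq> {v \<in> topspace T. v \<otimes> x \<in> topspace T - H}"
    by (rule small_subgroup)
  note V' = compact_open_subgroupD[OF V]
  define M where "M = V <#> H"
  have M: "subgroup M G" "openin T M"
    unfolding M_def using mult_subgroups[OF V'(1) H(1)] openin_set_mult[OF V'(3) subgroup.subset[OF H(1)]] by auto
  have HM: "H \<subseteq> M" unfolding M_def by (rule subset_set_mult_right[OF V'(1) subgroup.subset[OF H(1)]])
  have "x \<notin> M"
  proof
    assume "x \<in> M"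
    then obtain v h where vh: "v \<in> V" "h \<in> H" "x = v \<otimes> h" by (auto simp: M_def set_mult_def)
    have G: "v \<in> carrier G" "h \<in> carrier G" using vh V'(5) subgroup.subset[OF H(1)] by auto
    have "inv v \<in> V" using subgroup.m_inv_closed[OF V'(1) vh(1)] .
    then have "inv v \<otimes> x \<notin> H" using VH by blast
    moreover have "inv v \<otimes> x = h" using G vh(3) by (simp flip: m_assoc)
    ultimately show False using vh(2) by simp
  qed
  then obtain \<xi> where \<xi>: "\<xi> \<in> hom G circle_group" "\<forall>m\<in>M. \<xi> m = 1" "\<xi> x \<noteq> 1"
    using character_separates_subgroup[OF comm_group_axioms M(1) x(1)] by meson
  have "(\<lambda>y\<in>carrier G. \<xi> y) \<in> carrier dualG"
  proof (rule dual_carrierI)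
    show "continuous_map T circle_topology \<xi>" using character_continuousI[OF M \<xi>(1)] \<xi>(2) by simp
    show "\<xi> (y \<otimes> z) = \<xi> y * \<xi> z" if "y \<in> carrier G" "z \<in> carrier G" for y z
      using hom_mult[OF \<xi>(1) that] by simp
  qed
  then have "(\<lambda>y\<in>carrier G. \<xi> y) \<in> annih H"
    using HM \<xi>(2) subgroup.subset[OF H(1)] by (auto simp: annihilator_iff)
  then show ?thesis using \<xi>(3) x(1) by (intro bexI[of _ "\<lambda>y\<in>carrier G. \<xi> y"]) auto
qed

lemma coannihilator_annihilator:
  assumes H: "subgroup H G" "closedin T H"
  shows "coannihilator G (annih H) = H"
proof
  show "coannihilator G (annih H) \<subseteq> H"
    using closed_subgroup_separated[OF H] by (fastforce simp: coannihilator_def)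
  show "H \<subseteq> coannihilator G (annih H)"
    using subgroup.subset[OF H(1)] by (auto simp: coannihilator_def annihilator_iff)
qed

lemma annihilator_antimono_iff:
  assumes "subgroup H G" "closedin T H" "K \<subseteq> carrier G"
  shows "annih H \<subseteq> annih K \<longleftrightarrow> K \<subseteq> H"
proof
  assume le: "annih H \<subseteq> annih K"
  have "K \<subseteq> coannihilator G (annih H)"
    using le assms(3) by (auto simp: coannihilator_def annihilator_iff)
  then show "K \<subseteq> H" using coannihilator_annihilator[OF assms(1,2)] by simp
qed (rule annihilator_antimono)

lemma character_trivial_on_compact_open:
  assumes \<xi>: "\<xi> \<in> carrier dualG"
  obtains V where "V \<in> compact_open_subgroups G T" "\<xi> \<in> annih V"
proof -
  have cont: "continuous_map T euclidean \<xi>"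
    using dual_carrierD(3)[OF \<xi>] by (simp add: continuous_map_circle_iff)
  have "openin T {x \<in> topspace T. \<xi> x \<in> ball 1 (1/2)}"
    by (rule openin_continuous_map_preimage[OF cont]) simp
  moreover have "\<one> \<in> {x \<in> topspace T. \<xi> x \<in> ball 1 (1/2)}"
    using dual_carrierD(5)[OF \<xi>] by (simp add: topspace_eq_carrier)
  ultimately obtain V where V: "V \<in> compact_open_subgroups G T"
    and le: "V \<subseteq> {x \<in> topspace T. \<xi> x \<in> ball 1 (1/2)}"
    by (rule small_subgroup)
  have "cmod (\<xi> v - 1) < 1/2" if "v \<in> V" for v
    using subsetD[OF le that] by (simp add: dist_norm norm_minus_commute)
  then have "\<xi> \<in> annih V" using annihilator_near_1[OF \<xi> compact_open_subgroupD(1)[OF V]] by blast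
  with V that show ?thesis by blast
qed

text \<open>
  The annihilators of the compact open subgroups form an open cover of the dual group, and this
  cover is directed because compact open subgroups are closed under intersection.
\<close>

lemma compact_in_dual_annihilates_compact_open:
  assumes N: "compactin (dual_topology G T) N"
  obtains V where "V \<in> compact_open_subgroups G T" "N \<subseteq> annih V"
proof -
  have down: "\<exists>V\<in>compact_open_subgroups G T. \<forall>W\<in>F. V \<subseteq> W"
    if "finite F" "F \<subseteq> compact_open_subgroups G T" for F
    using that
  proof induction
    case empty
    obtain V where "V \<in> compact_open_subgroups G T"
      using small_subgroup[OF openin_topspace] topspace_eq_carrier one_closed by metis
    then show ?case by blast
  next
    case (insert W F)
    then obtain V where V: "V \<in> compact_open_subgroups G T" "\<forall>W\<in>F. V \<subseteq> W" by auto
    have "V \<inter> W \<in> compact_open_subgroups G T"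
      using compact_open_subgroup_Int[OF Hausdorff V(1)] insert.prems by simp
    then show ?case using V(2) by (intro bexI[of _ "V \<inter> W"]) auto
  qed
  let ?\<C> = "annih ` compact_open_subgroups G T"
  have "N \<subseteq> \<Union>?\<C>"
  proof
    fix \<xi> assume "\<xi> \<in> N"
    then have "\<xi> \<in> carrier dualG"
      using compactin_subset_topspace[OF N] topspace_dual_topology by auto
    then obtain V where "V \<in> compact_open_subgroups G T" "\<xi> \<in> annih V"
      by (rule character_trivial_on_compact_open)
    then show "\<xi> \<in> \<Union>?\<C>" by blast
  qed
  moreover have "openin (dual_topology G T) C" if C: "C \<in> ?\<C>" for C
  proof -
    obtain V where "V \<in> compact_open_subgroups G T" "C = annih V" using C by blast
    then show ?thesis using annihilator_openin compact_open_subgroupD(1,2) by simp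
  qed
  ultimately obtain \<F> where "finite \<F>" "\<F> \<subseteq> ?\<C>" "N \<subseteq> \<Union>\<F>"
    using compactinD[OF N, of ?\<C>] by meson
  then obtain F where F: "finite F" "F \<subseteq> compact_open_subgroups G T" "N \<subseteq> (\<Union>V\<in>F. annih V)"
    by (metis finite_subset_image)
  then obtain V where V: "V \<in> compact_open_subgroups G T" "\<forall>W\<in>F. V \<subseteq> W" using down by blast
  have "N \<subseteq> annih V"
  proof
    fix \<xi> assume "\<xi> \<in> N"
    then obtain W where "W \<in> F" "\<xi> \<in> annih W" using F(3) by blast
    then show "\<xi> \<in> annih V" using V(2) by (auto simp: annihilator_iff)
  qed
  with V(1) that show ?thesis by blast
qed

lemma annihilator_in_compact_open_subgroups:
  assumes "U \<in> compact_open_subgroups G T"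
  shows "annih U \<in> compact_open_subgroups dualG (dual_topology G T)"
  using compact_open_subgroupD[OF assms] annihilator_subgroup annihilator_openin annihilator_compactin
  by (simp add: compact_open_subgroups_def)

text \<open>
  Let \<open>\<psi>\<close> be the inverse of \<open>\<phi>\<close> and \<open>D\<close> the image of the annihilator of \<open>U\<close> under the dual map. Pair
  \<open>D\<close> with \<open>\<phi> ` U\<close> by evaluating \<open>\<eta> \<in> D\<close> at \<open>\<psi> y\<close>. A member of \<open>D\<close> lies in the left kernel if and only
  if it is trivial on \<open>U\<close>. If \<open>\<eta> = \<xi> \<circ> \<phi>\<close>, the value of the pairing is \<open>\<xi> y\<close>; so, annihilators
  being faithful on closed subgroups, \<open>y\<close> lies in the right kernel if and only if \<open>y \<in> U\<close>. Hence the
  two indices of the pairing are the two sides of the equation.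
\<close>

lemma scale_at_annihilator:
  assumes \<phi>: "topological_automorphism G T \<phi>" and U: "U \<in> compact_open_subgroups G T"
  shows "scale_at G \<phi> U = scale_at dualG (dual_map G \<phi>) (annih U)"
proof -
  note U' = compact_open_subgroupD[OF U]
  interpret D: comm_group dualG by (rule dual_comm_group)
  have iso: "\<phi> \<in> iso G G" and hm: "homeomorphic_map T T \<phi>"
    using \<phi> by (auto simp: topological_automorphism_def)
  then obtain \<psi> where "homeomorphic_maps T T \<phi> \<psi>" by (auto simp: homeomorphic_map_maps)
  then have cont: "continuous_map T T \<phi>" "continuous_map T T \<psi>"
    and inv1: "\<And>x. x \<in> carrier G \<Longrightarrow> \<psi> (\<phi> x) = x" and inv2: "\<And>y. y \<in> carrier G \<Longrightarrow> \<phi> (\<psi> y) = y"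
    by (auto simp: homeomorphic_maps_def topspace_eq_carrier)
  have c1: "\<phi> x \<in> carrier G" and c2: "\<psi> x \<in> carrier G" if "x \<in> carrier G" for x
    using continuous_map_funspace[OF cont(1)] continuous_map_funspace[OF cont(2)] that
    by (auto simp: topspace_eq_carrier)
  have m1: "\<phi> (x \<otimes> y) = \<phi> x \<otimes> \<phi> y" if "x \<in> carrier G" "y \<in> carrier G" for x y
    using iso that by (auto simp: iso_def hom_def)
  have m2: "\<psi> (x \<otimes> y) = \<psi> x \<otimes> \<psi> y" if "x \<in> carrier G" "y \<in> carrier G" for x y
    using m1[of "\<psi> x" "\<psi> y"] inv1[of "\<psi> x \<otimes> \<psi> y"] inv2 c2 that by simp
  let ?D = "dual_map G \<phi> ` annih U" and ?preU = "{x \<in> carrier G. \<phi> x \<in> U}"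
  \<comment> \<open>This description shows that \<open>D\<close> is a subgroup of the dual group.\<close>
  have D_eq: "?D = annih ?preU"
  proof
    show "?D \<subseteq> annih ?preU"
    proof
      fix \<eta> assume "\<eta> \<in> ?D"
      then obtain \<xi> where \<xi>: "\<xi> \<in> annih U" and \<eta>: "\<eta> = (\<lambda>x\<in>carrier G. \<xi> (\<phi> x))"
        by (auto simp: dual_map_def)
      then have \<xi>': "\<xi> \<in> carrier dualG" by (simp add: annihilator_iff)
      have "\<eta> \<in> carrier dualG" unfolding \<eta>
      proof (rule dual_carrierI)
        show "continuous_map T circle_topology (\<lambda>x. \<xi> (\<phi> x))"
          using continuous_map_compose[OF cont(1) dual_carrierD(3)[OF \<xi>']] by (simp add: o_def)
      qed (simp add: m1 c1 dual_carrierD(6)[OF \<xi>'])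
      then show "\<eta> \<in> annih ?preU" using \<xi> by (simp add: annihilator_iff \<eta>)
    qed
    show "annih ?preU \<subseteq> ?D"
    proof
      fix \<eta> assume \<eta>: "\<eta> \<in> annih ?preU"
      then have \<eta>': "\<eta> \<in> carrier dualG" by (simp add: annihilator_iff)
      let ?\<xi> = "\<lambda>y\<in>carrier G. \<eta> (\<psi> y)"
      have \<xi>: "?\<xi> \<in> carrier dualG"
      proof (rule dual_carrierI)
        show "continuous_map T circle_topology (\<lambda>x. \<eta> (\<psi> x))"
          using continuous_map_compose[OF cont(2) dual_carrierD(3)[OF \<eta>']] by (simp add: o_def)
      qed (simp add: m2 c2 dual_carrierD(6)[OF \<eta>'])
      have "?\<xi> u = 1" if u: "u \<in> U" for u
      proof -
        have uG: "u \<in> carrier G" using U'(5) u by (rule subsetD)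
        then have "\<psi> u \<in> ?preU" using c2 inv2 u by simp
        then show ?thesis using \<eta> uG by (simp add: annihilator_iff)
      qed
      then have mem: "?\<xi> \<in> annih U" using \<xi> unfolding annihilator_iff by blast
      have "\<eta> = dual_map G \<phi> ?\<xi>"
      proof (rule extensionalityI[OF dual_carrierD(1)[OF \<eta>']])
        show "dual_map G \<phi> ?\<xi> \<in> extensional (carrier G)" by (simp add: dual_map_def)
      qed (simp add: dual_map_def c1 inv1)
      then show "\<eta> \<in> ?D" using mem by (rule image_eqI)
    qed
  qed
  have D: "subgroup ?D dualG" unfolding D_eq by (rule annihilator_subgroup) auto
  have phom: "group_hom G G \<phi>"
    using iso by unfold_locales (auto simp: iso_def)
  have \<phi>U: "subgroup (\<phi> ` U) G" using group_hom.subgroup_img_is_subgroup[OF phom U'(1)] .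
  have \<phi>Uc: "compactin T (\<phi> ` U)" using image_compactin[OF U'(2) cont(1)] .
  have "openin T {y \<in> topspace T. \<psi> y \<in> U}" using openin_continuous_map_preimage[OF cont(2) U'(3)] .
  moreover have \<phi>U_eq: "\<phi> ` U = {y \<in> topspace T. \<psi> y \<in> U}"
  proof
    show "\<phi> ` U \<subseteq> {y \<in> topspace T. \<psi> y \<in> U}"
      using U'(5) c1 inv1 by (auto simp: topspace_eq_carrier subset_iff)
    show "{y \<in> topspace T. \<psi> y \<in> U} \<subseteq> \<phi> ` U"
    proof
      fix y assume "y \<in> {y \<in> topspace T. \<psi> y \<in> U}"
      then have "\<psi> y \<in> U" "\<phi> (\<psi> y) = y" using inv2 by (auto simp: topspace_eq_carrier)
      then show "y \<in> \<phi> ` U" by (metis imageI)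
    qed
  qed
  ultimately have "openin T (\<phi> ` U)" by simp
  then have op: "openin T (U \<inter> \<phi> ` U)" using U'(3) by (simp add: openin_Int)
  have sub: "subgroup (U \<inter> \<phi> ` U) G" using subgroups_Inter_pair[OF U'(1) \<phi>U] .
  have \<phi>UG: "\<phi> ` U \<subseteq> carrier G" using subgroup.subset[OF \<phi>U] .
  have co: "(\<forall>\<xi>\<in>annih U. \<xi> y = 1) \<longleftrightarrow> y \<in> U" if "y \<in> carrier G" for y
    using coannihilator_annihilator[OF U'(1,4)] that by (auto simp: coannihilator_def)
  have carriers: "carrier (G\<lparr>carrier := \<phi> ` U\<rparr>) = \<phi> ` U"
      "carrier (dualG\<lparr>carrier := ?D\<rparr>) = ?D" by simp_all
  have "card (rcosets\<^bsub>G\<lparr>carrier := \<phi> ` U\<rparr>\<^esub> (U \<inter> \<phi> ` U))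
      = card (rcosets\<^bsub>dualG\<lparr>carrier := ?D\<rparr>\<^esub> (annih U \<inter> ?D))"
  proof (rule pairing_index_eq[where f = "\<lambda>\<eta> y. \<eta> (\<psi> y)"])
    show "comm_group (G\<lparr>carrier := \<phi> ` U\<rparr>)" using subgroup_comm_group[OF \<phi>U] .
    show "comm_group (dualG\<lparr>carrier := ?D\<rparr>)" using D.subgroup_comm_group[OF D] .
    show "finite (rcosets\<^bsub>G\<lparr>carrier := \<phi> ` U\<rparr>\<^esub> (U \<inter> \<phi> ` U))"
      by (rule finite_rcosets_compact[OF \<phi>U \<phi>Uc sub op])
  next
    fix \<eta> \<zeta> y assume "\<eta> \<in> carrier (dualG\<lparr>carrier := ?D\<rparr>)" "y \<in> carrier (G\<lparr>carrier := \<phi> ` U\<rparr>)"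
    then have a: "\<eta> \<in> carrier dualG" "y \<in> carrier G"
      using subgroup.mem_carrier[OF D] subgroup.mem_carrier[OF \<phi>U] by simp_all
    show "\<eta> (\<psi> y) \<noteq> 0" using dual_carrierD(4)[OF a(1) c2[OF a(2)]] by auto
    show "(\<eta> \<otimes>\<^bsub>dualG\<lparr>carrier := ?D\<rparr>\<^esub> \<zeta>) (\<psi> y) = \<eta> (\<psi> y) * \<zeta> (\<psi> y)"
      using dual_mult[OF c2[OF a(2)]] by simp
    fix z assume "z \<in> carrier (G\<lparr>carrier := \<phi> ` U\<rparr>)"
    then have "z \<in> carrier G" using subgroup.mem_carrier[OF \<phi>U] by simp
    then show "\<eta> (\<psi> (y \<otimes>\<^bsub>G\<lparr>carrier := \<phi> ` U\<rparr>\<^esub> z)) = \<eta> (\<psi> y) * \<eta> (\<psi> z)"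
      using a by (simp add: m2 c2 dual_carrierD(6)[OF a(1)])
  next
    have "(\<forall>\<eta>\<in>?D. \<eta> (\<psi> y) = 1) \<longleftrightarrow> y \<in> U" if y: "y \<in> \<phi> ` U" for y
    proof -
      have yG: "y \<in> carrier G" using \<phi>UG y by (rule subsetD)
      have "(\<forall>\<eta>\<in>?D. \<eta> (\<psi> y) = 1) \<longleftrightarrow> (\<forall>\<xi>\<in>annih U. \<xi> y = 1)"
        using yG by (simp add: dual_map_def c2 inv2)
      then show ?thesis using co[OF yG] by simp
    qed
    then show "U \<inter> \<phi> ` U = {y \<in> carrier (G\<lparr>carrier := \<phi> ` U\<rparr>).
        \<forall>\<eta>\<in>carrier (dualG\<lparr>carrier := ?D\<rparr>). \<eta> (\<psi> y) = 1}"
      unfolding carriers by blast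
    have *: "(\<forall>y\<in>\<phi> ` U. \<eta> (\<psi> y) = 1) \<longleftrightarrow> (\<forall>u\<in>U. \<eta> u = 1)" for \<eta>
      using U'(5) inv1 by (simp add: subset_iff)
    have "annih U \<inter> X = {\<eta> \<in> X. \<forall>u\<in>U. \<eta> u = 1}" if "X \<subseteq> carrier dualG" for X
      using that by (auto simp: annihilator_iff)
    from this[OF subgroup.subset[OF D]]
    show "annih U \<inter> ?D = {\<eta> \<in> carrier (dualG\<lparr>carrier := ?D\<rparr>).
        \<forall>y\<in>carrier (G\<lparr>carrier := \<phi> ` U\<rparr>). \<eta> (\<psi> y) = 1}"
      unfolding carriers * .
  qed
  then show ?thesis by (simp add: scale_at_def subgroup_index_def)
qed

text \<open>
  Evaluation pairs \<open>N\<close> with \<open>W\<close>. The right kernel consists of elements of \<open>W\<close>, and it is all of the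
  coannihilator, since the coannihilator of \<open>N\<close> is contained in that of \<open>annih W\<close>, which is \<open>W\<close>.
\<close>

lemma annihilator_index:
  assumes W: "W \<in> compact_open_subgroups G T" and N: "subgroup N dualG" "annih W \<subseteq> N"
    and op: "openin T (coannihilator G N)"
  shows "card (rcosets\<^bsub>G\<lparr>carrier := W\<rparr>\<^esub> (coannihilator G N))
    = card (rcosets\<^bsub>dualG\<lparr>carrier := N\<rparr>\<^esub> (annih W))"
proof -
  interpret D: comm_group dualG by (rule dual_comm_group)
  note W' = compact_open_subgroupD[OF W]
  have co: "subgroup (coannihilator G N) G"
    using coannihilator_subgroup[OF subgroup.subset[OF N(1)]] .
  have le: "coannihilator G N \<subseteq> W"
    using N(2) coannihilator_annihilator[OF W'(1,4)] by (auto simp: coannihilator_def)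
  show ?thesis
  proof (rule pairing_index_eq[where f = "\<lambda>\<xi> x. \<xi> x"])
    show "comm_group (G\<lparr>carrier := W\<rparr>)" using subgroup_comm_group[OF W'(1)] .
    show "comm_group (dualG\<lparr>carrier := N\<rparr>)" using D.subgroup_comm_group[OF N(1)] .
    show "finite (rcosets\<^bsub>G\<lparr>carrier := W\<rparr>\<^esub> (coannihilator G N))"
      by (rule finite_rcosets_compact[OF W'(1,2) co op])
    show "coannihilator G N = {x \<in> carrier (G\<lparr>carrier := W\<rparr>).
        \<forall>\<xi>\<in>carrier (dualG\<lparr>carrier := N\<rparr>). \<xi> x = 1}"
      using le W'(5) by (auto simp: coannihilator_def)
    show "annih W = {\<xi> \<in> carrier (dualG\<lparr>carrier := N\<rparr>).
        \<forall>x\<in>carrier (G\<lparr>carrier := W\<rparr>). \<xi> x = 1}"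
      using N(2) subgroup.subset[OF N(1)] by (auto simp: annihilator_iff)
  next
    fix \<xi> \<zeta> x assume "\<xi> \<in> carrier (dualG\<lparr>carrier := N\<rparr>)" "x \<in> carrier (G\<lparr>carrier := W\<rparr>)"
    then have a: "\<xi> \<in> carrier dualG" "x \<in> carrier G"
      using subgroup.mem_carrier[OF N(1)] subgroup.mem_carrier[OF W'(1)] by simp_all
    show "\<xi> x \<noteq> 0" using dual_carrierD(4)[OF a] by auto
    show "(\<xi> \<otimes>\<^bsub>dualG\<lparr>carrier := N\<rparr>\<^esub> \<zeta>) x = \<xi> x * \<zeta> x" using dual_mult[OF a(2)] by simp
    fix z assume "z \<in> carrier (G\<lparr>carrier := W\<rparr>)"
    then have "z \<in> carrier G" using subgroup.mem_carrier[OF W'(1)] by simp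
    then show "\<xi> (x \<otimes>\<^bsub>G\<lparr>carrier := W\<rparr>\<^esub> z) = \<xi> x * \<xi> z"
      using dual_carrierD(6)[OF a] by simp
  qed
qed

end

section \<open>Compactly covered groups\<close>

locale compactly_covered_tdlc_abelian_group = tdlc_abelian_group +
  assumes compactly_covered: "compactly_covered G T"
begin

text \<open>
  Compact coverage enters here: the compact set that controls a neighbourhood of the trivial character
  can be enlarged to a compact open subgroup.
\<close>

lemma open_dual_subgroup_contains_annihilator:
  assumes N: "subgroup N dualG" "openin (dual_topology G T) N"
  obtains W where "W \<in> compact_open_subgroups G T" "annih W \<subseteq> N"
proof -
  obtain K where K: "compactin T K" "annih K \<subseteq> N"
    using open_dual_contains_annihilator[OF N(2) subgroup.one_closed[OF N(1)]] by blast
  obtain W where W: "W \<in> compact_open_subgroups G T" "K \<subseteq> W"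
    using compact_subset_compact_open_subgroup[OF totally_disconnected compactly_covered K(1)] .
  have "annih W \<subseteq> annih K" using W(2) by (rule annihilator_antimono)
  then show ?thesis using that W(1) K(2) by (meson order_trans)
qed

text \<open>
  For the converse, openness of \<open>annih U\<close> bounds \<open>U\<close> from above by a compact open subgroup \<open>W\<close>, and
  compactness of \<open>annih U\<close> bounds \<open>U\<close> from below by a compact open subgroup \<open>V\<close>.
\<close>

lemma compact_open_subgroup_iff_annihilator:
  assumes U: "subgroup U G" "closedin T U"
  shows "U \<in> compact_open_subgroups G T
    \<longleftrightarrow> annih U \<in> compact_open_subgroups dualG (dual_topology G T)"
proof
  assume A: "annih U \<in> compact_open_subgroups dualG (dual_topology G T)"
  then have A': "subgroup (annih U) dualG" "compactin (dual_topology G T) (annih U)"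
      "openin (dual_topology G T) (annih U)" by (auto simp: compact_open_subgroups_def)
  obtain W where W: "W \<in> compact_open_subgroups G T" "annih W \<subseteq> annih U"
    using open_dual_subgroup_contains_annihilator[OF A'(1,3)] .
  note W' = compact_open_subgroupD[OF W(1)]
  have "U \<subseteq> W" using annihilator_antimono_iff[OF W'(1,4) subgroup.subset[OF U(1)]] W(2) by simp
  then have cU: "compactin T U" by (rule closed_compactin[OF W'(2) _ U(2)])
  obtain V where V: "V \<in> compact_open_subgroups G T" "annih U \<subseteq> annih V"
    using compact_in_dual_annihilates_compact_open[OF A'(2)] .
  note V' = compact_open_subgroupD[OF V(1)]
  have "V \<subseteq> U" using annihilator_antimono_iff[OF U V'(5)] V(2) by simp
  then have "openin T U" by (rule open_subgroupI[OF U(1) V'(3) subgroup.one_closed[OF V'(1)]])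
  then show "U \<in> compact_open_subgroups G T" using cU U(1) by (simp add: compact_open_subgroups_def)
qed (rule annihilator_in_compact_open_subgroups)

text \<open>
  Let \<open>U\<close> be the coannihilator of \<open>N\<close>. Then \<open>N \<subseteq> annih U\<close>, and both contain \<open>annih W\<close> for a compact
  open subgroup \<open>W\<close>. Since \<open>N\<close> and \<open>annih U\<close> have the same coannihilator \<open>U\<close>, both have index
  \<open>[W : U]\<close> over \<open>annih W\<close>. This index is finite, so they are equal. Counting replaces the
  biduality theorem.
\<close>

lemma compact_open_dual_subgroup_is_annihilator:
  assumes N: "N \<in> compact_open_subgroups dualG (dual_topology G T)"
  obtains U where "U \<in> compact_open_subgroups G T" "N = annih U"
proof -
  interpret D: comm_group dualG by (rule dual_comm_group)
  have N': "subgroup N dualG" "compactin (dual_topology G T) N" "openin (dual_topology G T) N"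
    using N by (auto simp: compact_open_subgroups_def)
  have Nc: "N \<subseteq> carrier dualG" using subgroup.subset[OF N'(1)] .
  define U where "U = coannihilator G N"
  have sU: "subgroup U G" unfolding U_def by (rule coannihilator_subgroup[OF Nc])
  obtain W where W: "W \<in> compact_open_subgroups G T" "annih W \<subseteq> N"
    using open_dual_subgroup_contains_annihilator[OF N'(1,3)] .
  note W' = compact_open_subgroupD[OF W(1)]
  obtain V where V: "V \<in> compact_open_subgroups G T" "N \<subseteq> annih V"
    using compact_in_dual_annihilates_compact_open[OF N'(2)] .
  note V' = compact_open_subgroupD[OF V(1)]
  have "V \<subseteq> U" using V(2) V'(5) by (auto simp: U_def coannihilator_def annihilator_iff)
  then have oU: "openin T U" by (rule open_subgroupI[OF sU V'(3) subgroup.one_closed[OF V'(1)]])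
  then have clU: "closedin T U" by (rule open_subgroup_closedin[OF sU])
  have UW: "U \<subseteq> W"
    using W(2) coannihilator_annihilator[OF W'(1,4)] by (auto simp: U_def coannihilator_def)
  then have "compactin T U" by (rule closed_compactin[OF W'(2) _ clU])
  then have U: "U \<in> compact_open_subgroups G T" using sU oU by (simp add: compact_open_subgroups_def)
  have N_le: "N \<subseteq> annih U" using Nc by (auto simp: U_def coannihilator_def annihilator_iff)
  have sA: "subgroup (annih U) dualG" by (rule annihilator_subgroup[OF subgroup.subset[OF sU]])
  have U_eq: "coannihilator G (annih U) = U" by (rule coannihilator_annihilator[OF sU clU])
  let ?cos = "\<lambda>M. rcosets\<^bsub>dualG\<lparr>carrier := M\<rparr>\<^esub> (annih W)"
  have cos_eq: "?cos M = (\<lambda>\<xi>. annih W #>\<^bsub>dualG\<^esub> \<xi>) ` M" for M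
    by (auto simp: RCOSETS_def r_coset_def)
  have index_N: "card (rcosets\<^bsub>G\<lparr>carrier := W\<rparr>\<^esub> U) = card (?cos N)"
    using annihilator_index[OF W(1) N'(1) W(2)] oU by (simp add: U_def)
  have index_A: "card (rcosets\<^bsub>G\<lparr>carrier := W\<rparr>\<^esub> U) = card (?cos (annih U))"
    using annihilator_index[OF W(1) sA order_trans[OF W(2) N_le]] oU by (simp add: U_eq)
  have "finite (rcosets\<^bsub>G\<lparr>carrier := W\<rparr>\<^esub> U)" by (rule finite_rcosets_compact[OF W'(1,2) sU oU])
  moreover have "rcosets\<^bsub>G\<lparr>carrier := W\<rparr>\<^esub> U \<noteq> {}"
    using subgroup.one_closed[OF W'(1)] by (auto simp: RCOSETS_def)
  ultimately have "card (?cos (annih U)) > 0" unfolding index_A[symmetric] card_gt_0_iff by blast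
  then have "finite (?cos (annih U))" by (rule card_ge_0_finite)
  moreover have "?cos N \<subseteq> ?cos (annih U)" unfolding cos_eq using N_le by (rule image_mono)
  ultimately have same: "?cos N = ?cos (annih U)"
    using index_N index_A by (intro card_subset_eq) simp_all
  have "annih U \<subseteq> N"
  proof
    fix \<xi> assume \<xi>: "\<xi> \<in> annih U"
    have sW: "subgroup (annih W) dualG" by (rule annihilator_subgroup[OF W'(5)])
    have "annih W #>\<^bsub>dualG\<^esub> \<xi> \<in> ?cos N" unfolding same cos_eq using \<xi> by (rule imageI)
    then obtain \<eta> where \<eta>: "\<eta> \<in> N" "annih W #>\<^bsub>dualG\<^esub> \<xi> = annih W #>\<^bsub>dualG\<^esub> \<eta>"
      unfolding cos_eq by (elim imageE) (rule that)
    have "\<xi> \<in> annih W #>\<^bsub>dualG\<^esub> \<eta>"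
      using D.rcos_self[OF subgroup.mem_carrier[OF sA \<xi>] sW] \<eta>(2) by simp
    then obtain \<zeta> where "\<zeta> \<in> annih W" "\<xi> = \<zeta> \<otimes>\<^bsub>dualG\<^esub> \<eta>" by (auto simp: r_coset_def)
    then show "\<xi> \<in> N" using subgroup.m_closed[OF N'(1) subsetD[OF W(2)] \<eta>(1)] by simp
  qed
  with N_le U that show ?thesis by (metis subset_antisym)
qed

text \<open>
  Taking annihilators maps the compact open subgroups of \<open>G\<close> onto those of the dual group and preserves
  the index, so the two minima are taken over the same set of numbers.
\<close>

lemma scale_aut_dual:
  assumes \<phi>: "topological_automorphism G T \<phi>"
  shows "scale_aut dualG (dual_topology G T) (dual_map G \<phi>) = scale_aut G T \<phi>"
proof -
  have "(\<exists>N\<in>compact_open_subgroups dualG (dual_topology G T). n = scale_at dualG (dual_map G \<phi>) N)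
      \<longleftrightarrow> (\<exists>U\<in>compact_open_subgroups G T. n = scale_at G \<phi> U)" (is "?l \<longleftrightarrow> ?r") for n
  proof
    assume ?l
    then obtain N where N: "N \<in> compact_open_subgroups dualG (dual_topology G T)"
      "n = scale_at dualG (dual_map G \<phi>) N" by (rule bexE)
    obtain U where "U \<in> compact_open_subgroups G T" "N = annih U"
      using compact_open_dual_subgroup_is_annihilator[OF N(1)] .
    then show ?r using N(2) scale_at_annihilator[OF \<phi>] by (intro bexI[of _ U]) simp_all
  next
    assume ?r
    then obtain U where U: "U \<in> compact_open_subgroups G T" "n = scale_at G \<phi> U" by (rule bexE)
    then show ?l using scale_at_annihilator[OF \<phi> U(1)] annihilator_in_compact_open_subgroups[OF U(1)]
      by (intro bexI[of _ "annih U"]) simp_all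
  qed
  then show ?thesis by (simp only: scale_aut_def)
qed

end

theorem theorem5p5:
  fixes G :: "('a, 'm) monoid_scheme" and T :: "'a topology" and \<phi> :: "'a \<Rightarrow> 'a"
  assumes "locally_compact_abelian_group G T"
    and "totally_disconnected_space T"
    and "compactly_covered G T"
    and "topological_automorphism G T \<phi>"
  shows "(\<forall>U. subgroup U G \<and> closedin T U \<longrightarrow>
            (U \<in> compact_open_subgroups G T \<longleftrightarrow>
             annihilator_in_dual G T U
               \<in> compact_open_subgroups (dual_group G T) (dual_topology G T)))
       \<and> (\<forall>U \<in> compact_open_subgroups G T.
            scale_at G \<phi> U
              = scale_at (dual_group G T) (dual_map G \<phi>) (annihilator_in_dual G T U))
       \<and> (\<forall>U. subgroup U G \<and> closedin T U \<longrightarrow>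
            (U \<in> minimizing_subgroups G T \<phi> \<longleftrightarrow>
             annihilator_in_dual G T U
               \<in> minimizing_subgroups (dual_group G T) (dual_topology G T) (dual_map G \<phi>)))
       \<and> scale_aut (dual_group G T) (dual_topology G T) (dual_map G \<phi>) = scale_aut G T \<phi>"
proof -
  interpret locally_compact_abelian_group G T by fact
  interpret compactly_covered_tdlc_abelian_group G T by unfold_locales fact+
  note a = compact_open_subgroup_iff_annihilator
  note b = scale_at_annihilator[OF assms(4)]
  note d = scale_aut_dual[OF assms(4)]
  have c: "U \<in> minimizing_subgroups G T \<phi> \<longleftrightarrow>
      annih U \<in> minimizing_subgroups dualG (dual_topology G T) (dual_map G \<phi>)"
    if U: "subgroup U G" "closedin T U" for U
  proof (cases "U \<in> compact_open_subgroups G T")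
    case True
    then show ?thesis using a[OF U] b[OF True] d by (simp add: minimizing_subgroups_def)
  next
    case False
    then show ?thesis using a[OF U] by (simp add: minimizing_subgroups_def)
  qed
  show ?thesis
  proof (intro conjI allI impI ballI)
    fix U assume "subgroup U G \<and> closedin T U"
    then have U: "subgroup U G" "closedin T U" by auto
    show "U \<in> compact_open_subgroups G T \<longleftrightarrow> annih U \<in> compact_open_subgroups dualG (dual_topology G T)"
      by (rule a[OF U])
    show "U \<in> minimizing_subgroups G T \<phi> \<longleftrightarrow>
        annih U \<in> minimizing_subgroups dualG (dual_topology G T) (dual_map G \<phi>)"
      by (rule c[OF U])
  qed (rule b d, assumption?)+
qed

end
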